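(* Let $n\geqslant 2.16\times 10^{17}$ and let $G$ be a planar graph on $n$ vertices that does not contain $C_3\cdot C_3$ (the graph obtained from $K_4$ by deleting one edge) as a subgraph. Then $\rho(G)\leqslant \rho(K_{2,n-2})$, with equality if and only if $G\cong K_{2,n-2}$.
   Context: All graphs are finite and simple. $\rho(G)$ denotes the spectral radius of the adjacency matrix of $G$. $C_a\cdot C_b$ denotes the graph obtained from cycles $C_a$ and $C_b$ by identifying an edge of $C_a$ with an edge of $C_b$; thus $C_3\cdot C_3$ is two triangles sharing an edge, i.e. $K_4$ minus an edge. $K_{2,n-2}$ is the complete bipartite graph with parts of sizes $2$ and $n-2$. *)

theory Defs
  imports "HOL-Analysis.Analysis" "Jordan_Normal_Form.Spectral_Radius"
begin

definition simple_graph :: "nat \<Rightarrow> nat set set \<Rightarrow> bool" where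
  "simple_graph n E \<longleftrightarrow> (\<forall>e\<in>E. \<exists>u v. u \<noteq> v \<and> u < n \<and> v < n \<and> e = {u, v})"

definition adj_matrix :: "nat \<Rightarrow> nat set set \<Rightarrow> complex Matrix.mat" where
  "adj_matrix n E = Matrix.mat n n (\<lambda>(i, j). if {i, j} \<in> E then 1 else 0)"

definition graph_spectral_radius :: "nat \<Rightarrow> nat set set \<Rightarrow> real" where
  "graph_spectral_radius n E = spectral_radius (adj_matrix n E)"

definition K2n :: "nat \<Rightarrow> nat set set" where
  "K2n n = {{i, j} | i j. i < 2 \<and> 2 \<le> j \<and> j < n}"

definition graph_iso :: "nat \<Rightarrow> nat set set \<Rightarrow> nat set set \<Rightarrow> bool" where
  "graph_iso n E F \<longleftrightarrow> (\<exists>f. bij_betw f {0..<n} {0..<n} \<and>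
     (\<forall>u\<in>{0..<n}. \<forall>v\<in>{0..<n}. {u, v} \<in> E \<longleftrightarrow> {f u, f v} \<in> F))"

definition contains_C3C3 :: "nat set set \<Rightarrow> bool" where
  "contains_C3C3 E \<longleftrightarrow> (\<exists>a b c d. distinct [a, b, c, d] \<and>
     {a, b} \<in> E \<and> {a, c} \<in> E \<and> {b, c} \<in> E \<and> {a, d} \<in> E \<and> {b, d} \<in> E)"

definition planar :: "nat \<Rightarrow> nat set set \<Rightarrow> bool" where
  "planar n E \<longleftrightarrow> (\<exists>(p :: nat \<Rightarrow> complex) (\<gamma> :: nat set \<Rightarrow> real \<Rightarrow> complex).
     inj_on p {0..<n} \<and>
     (\<forall>u v. {u, v} \<in> E \<longrightarrow> u < v \<longrightarrow>
        arc (\<gamma> {u, v}) \<and> pathstart (\<gamma> {u, v}) = p u \<and> pathfinish (\<gamma> {u, v}) = p v \<and>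
        path_image (\<gamma> {u, v}) \<inter> p ` {0..<n} = {p u, p v}) \<and>
     (\<forall>e\<in>E. \<forall>e'\<in>E. e \<noteq> e' \<longrightarrow> path_image (\<gamma> e) \<inter> path_image (\<gamma> e') \<subseteq> p ` (e \<inter> e')))"

end

theory Submission
  imports Defs
begin

text \<open>
  Let \<open>\<lambda> = \<rho>(G)\<close> and let \<open>x\<close> be the vector of moduli of an eigenvector of modulus \<open>\<lambda>\<close>, scaled to
  maximum \<open>1\<close>, attained at \<open>u\<close>. Then \<open>\<lambda> x \<le> A x\<close> entrywise, which is all that is needed about \<open>x\<close>, and
  we may assume \<open>\<lambda>\<^sup>2 \<ge> 2(n - 2)\<close>.

  Planarity enters through one topological fact: there are no vertices \<open>a, b, c\<close> and disjoint
  connected vertex sets \<open>U, U', {v}\<close> that are all adjacent to each of \<open>a, b, c\<close>. It forbids \<open>K\<^sub>3\<^sub>,\<^sub>3\<close>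
  subgraphs, and it bounds the number of edges inside any vertex set \<open>S\<close> by \<open>6|S|\<close>: in a denser graph
  some connected \<open>U\<close> has a neighbourhood of minimum degree at least \<open>6\<close>, inside which some
  connected \<open>U'\<close> has a neighbourhood of minimum degree at least \<open>3\<close>.

  Counting walks of length two with these bounds shows that only boundedly many entries of \<open>x\<close> are
  at least \<open>1/400\<close>, that \<open>u\<close> is adjacent to almost all vertices, and that so is a second vertex \<open>v\<close>.
  Let \<open>A\<close> be the set of common neighbours of \<open>u\<close> and \<open>v\<close>, and \<open>R\<close> the set of the remaining vertices. As
  \<open>G\<close> is \<open>C\<^sub>3 \<cdot> C\<^sub>3\<close>-free, \<open>A\<close> is independent and \<open>u, v\<close> are not adjacent; all entries of \<open>x\<close> on
  \<open>A \<union> R\<close> are at most some \<open>m < 1/16\<close>. A last count gives \<open>2(n - 2) \<le> \<lambda>\<^sup>2 \<le> 2|A| + (1 + 16m)|R|\<close> with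
  \<open>|A| + |R| = n - 2\<close>, hence \<open>R = {}\<close> and \<open>G\<close> is \<open>K\<^sub>2\<^sub>,\<^sub>n\<^sub>-\<^sub>2\<close>.
\<close>

section \<open>Theta curves and tripods in the plane\<close>

text \<open>A connected set off a Jordan curve stays on one side of it, so \<open>D\<close> can be
  the other side. The frontier of that side is the whole curve, hence every point of the curve is an
  accumulation point of \<open>D\<close>.\<close>

lemma jordan_avoiding_component:
  fixes K :: "complex set"
  assumes "simple_path g" "pathfinish g = pathstart g" "connected K" "K \<inter> path_image g = {}"
  obtains D where "connected D" "D \<noteq> {}" "D \<inter> path_image g = {}" "path_image g \<subseteq> closure D"
    "D \<inter> K = {}" "\<And>x y. x \<in> D \<Longrightarrow> y \<in> K \<Longrightarrow> \<not> connected_component (- path_image g) x y"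
proof -
  let ?J = "path_image g" and ?I = "inside (path_image g)" and ?O = "outside (path_image g)"
  note jo = Jordan_inside_outside[OF assms(1,2)]
  have split: "T \<subseteq> ?I \<or> T \<subseteq> ?O" if "connected T" "T \<subseteq> - ?J" for T
    using connectedD[OF that(1), of ?I ?O] jo that(2) by blast
  have sep: "\<not> connected_component (- ?J) x y" if "x \<in> ?I" "y \<in> ?O" for x y
  proof
    assume "connected_component (- ?J) x y"
    then obtain T where "connected T" "T \<subseteq> - ?J" "x \<in> T" "y \<in> T"
      by (auto simp: connected_component_def)
    with split[of T] jo that show False by blast
  qed
  have cl: "?J \<subseteq> closure ?I" "?J \<subseteq> closure ?O"
    using jo by (metis Diff_subset frontier_def)+
  have IO: "?I \<inter> ?O = {}" "?I \<inter> ?J = {}" "?O \<inter> ?J = {}"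
    using jo by auto
  have "K \<subseteq> ?I \<or> K \<subseteq> ?O"
    using split assms(3,4) by blast
  then show thesis
  proof
    assume K: "K \<subseteq> ?I"
    show thesis
    proof (rule that[of ?O])
      show "connected ?O" "?O \<noteq> {}" using jo by auto
      show "?O \<inter> K = {}" using K IO(1) by blast
      show "\<not> connected_component (- ?J) x y" if "x \<in> ?O" "y \<in> K" for x y
        using K that sep[of y x] connected_component_sym[of "- ?J" x y] by blast
    qed (fact cl(2) IO(3))+
  next
    assume K: "K \<subseteq> ?O"
    show thesis
    proof (rule that[of ?I])
      show "connected ?I" "?I \<noteq> {}" using jo by auto
      show "?I \<inter> K = {}" using K IO(1) by blast
      show "\<not> connected_component (- ?J) x y" if "x \<in> ?I" "y \<in> K" for x y
        using K that sep[of x y] by blast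
    qed (fact cl(1) IO(2))+
  qed
qed

text \<open>Some component \<open>D\<close> of the complement of the closed curve \<open>ga \<union> gc\<close> avoids \<open>gb\<close> and \<open>Z\<close>. Both \<open>D\<close>
  and \<open>Z\<close> accumulate at \<open>a\<close> and at \<open>c\<close>, so neither \<open>ga \<union> gb\<close> nor \<open>gb \<union> gc\<close> separates them; by
  Janiszewski's theorem the union of these two curves does not separate them either, a contradiction.\<close>

lemma theta_curve_no_common_face:
  fixes ga gb gc :: "real \<Rightarrow> complex"
  assumes arcs: "arc ga" "arc gb" "arc gc"
    and start: "pathstart ga = p" "pathstart gb = p" "pathstart gc = p"
    and finish: "pathfinish ga = q" "pathfinish gb = q" "pathfinish gc = q"
    and meet: "path_image ga \<inter> path_image gb \<subseteq> {p, q}" "path_image ga \<inter> path_image gc \<subseteq> {p, q}"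
      "path_image gb \<inter> path_image gc \<subseteq> {p, q}"
    and pts: "a \<in> path_image ga - {p, q}" "b \<in> path_image gb - {p, q}" "c \<in> path_image gc - {p, q}"
    and Z: "connected Z" "Z \<inter> (path_image ga \<union> path_image gb \<union> path_image gc) = {}"
      "a \<in> closure Z" "b \<in> closure Z" "c \<in> closure Z"
  shows False
proof -
  let ?A = "path_image ga" and ?B = "path_image gb" and ?C = "path_image gc"
  have pq: "p \<in> ?A" "p \<in> ?B" "p \<in> ?C" "q \<in> ?A" "q \<in> ?B" "q \<in> ?C"
    using start finish by (metis pathstart_in_path_image pathfinish_in_path_image)+
  have "Z \<noteq> {}" using Z(3) by auto
  let ?g = "ga +++ reversepath gc"
  have img: "path_image ?g = ?A \<union> ?C"
    by (simp add: path_image_join start finish)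
  have sg: "simple_path ?g"
    using arcs start finish meet by (intro simple_path_join_loop) (auto simp: arc_reversepath)
  \<comment> \<open>Since \<open>b\<close> is an accumulation point of \<open>Z\<close>, the open
    arc of \<open>gb\<close> and \<open>Z\<close> are joined at \<open>b\<close> into one connected
    set, so a single face \<open>D\<close> avoids both.\<close>
  let ?K = "(?B - {p, q}) \<union> Z"
  have ZI: "connected (insert x Z)" if "x \<in> closure Z" for x
    by (rule connected_intermediate_closure[of Z]) (use Z(1) that closure_subset[of Z] in auto)
  have "connected (?B - {p, q})"
    using connected_simple_path_endless[OF arc_imp_simple_path[OF arcs(2)]] start finish by simp
  then have "connected ((?B - {p, q}) \<union> insert b Z)"
    using ZI[OF Z(4)] pts by (intro connected_Un) auto
  moreover have "(?B - {p, q}) \<union> insert b Z = ?K" using pts by auto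
  ultimately have "connected ?K" by simp
  moreover have "?K \<inter> path_image ?g = {}"
    using img Z(2) meet by auto
  ultimately obtain D where D: "connected D" "D \<noteq> {}" "D \<inter> path_image ?g = {}" "path_image ?g \<subseteq> closure D"
    "D \<inter> ?K = {}" and sep: "\<And>x y. x \<in> D \<Longrightarrow> y \<in> ?K \<Longrightarrow> \<not> connected_component (- path_image ?g) x y"
    using jordan_avoiding_component[OF sg, of ?K] start finish by auto
  obtain x y where x: "x \<in> D" and y: "y \<in> Z" using D(2) \<open>Z \<noteq> {}\<close> by blast
  have DI: "connected (insert t D)" if "t \<in> closure D" for t
    by (rule connected_intermediate_closure[of D]) (use D(1) that closure_subset[of D] in auto)
  have DB: "D \<inter> (?A \<union> ?B \<union> ?C) = {}"
    using D(3,5) img pq by auto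
  have "connected (insert t D \<union> insert t Z)" if "t \<in> closure D" "t \<in> closure Z" for t
    by (rule connected_Un) (use DI ZI that in auto)
  then have "connected (insert c D \<union> insert c Z)" "connected (insert a D \<union> insert a Z)"
    using Z(3,5) D(4) img pts(1,3) by auto
  moreover have "insert c D \<union> insert c Z \<subseteq> - (?A \<union> ?B)" "insert a D \<union> insert a Z \<subseteq> - (?B \<union> ?C)"
    using DB Z(2) pts meet by auto
  ultimately have "connected_component (- (?A \<union> ?B)) x y" "connected_component (- (?B \<union> ?C)) x y"
    using x y by (auto intro: connected_componentI)
  \<comment> \<open>Janiszewski's theorem asks for a connected intersection of the two sets; here it
    is exactly the arc \<open>?B\<close>.\<close>
  moreover have "(?A \<union> ?B) \<inter> (?B \<union> ?C) = ?B"
    using meet pq by auto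
  moreover have "connected ?B" "compact (?A \<union> ?B)" "closed (?B \<union> ?C)"
    using arcs by (auto intro!: compact_Un closed_Un connected_arc_image compact_arc_image closed_arc_image)
  ultimately have "connected_component (- ((?A \<union> ?B) \<union> (?B \<union> ?C))) x y"
    by (metis Janiszewski)
  then have "connected_component (- path_image ?g) x y"
    by (rule connected_component_of_subset) (use img in auto)
  then show False using sep x y by auto
qed

text \<open>The trace in the plane of one branch set of a K33 model with its three legs. The centre
  \<open>p\<close> is existential because it need not be the image of a vertex.\<close>

definition contains_tripod :: "complex set \<Rightarrow> complex \<Rightarrow> complex \<Rightarrow> complex \<Rightarrow> bool" where
  "contains_tripod X a b c \<longleftrightarrow> (\<exists>p ga gb gc. arc ga \<and> arc gb \<and> arc gc \<and>
     pathstart ga = p \<and> pathstart gb = p \<and> pathstart gc = p \<and>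
     pathfinish ga = a \<and> pathfinish gb = b \<and> pathfinish gc = c \<and>
     path_image ga \<inter> path_image gb = {p} \<and> path_image ga \<inter> path_image gc = {p} \<and>
     path_image gb \<inter> path_image gc = {p} \<and>
     path_image ga \<union> path_image gb \<union> path_image gc \<subseteq> X)"

text \<open>Join \<open>a\<close> to \<open>b\<close> by an arc \<open>g\<close> through
  \<open>Y\<close> and two of the legs, then walk from \<open>c\<close> through the third leg and
  \<open>Y\<close> until \<open>g\<close> is first met. That meeting point is the centre of the
  tripod.\<close>

lemma contains_tripodI:
  assumes Y: "closed Y" "path_connected Y"
    and arcs: "arc ga" "arc gb" "arc gc"
    and start: "pathstart ga = a" "pathstart gb = b" "pathstart gc = c"
    and finish: "pathfinish ga \<in> Y" "pathfinish gb \<in> Y" "pathfinish gc \<in> Y"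
    and notin: "a \<notin> Y \<union> path_image gb \<union> path_image gc" "b \<notin> Y \<union> path_image ga \<union> path_image gc"
      "c \<notin> Y \<union> path_image ga \<union> path_image gb"
    and meet: "path_image ga \<inter> path_image gb \<subseteq> Y"
  shows "contains_tripod (Y \<union> path_image ga \<union> path_image gb \<union> path_image gc) a b c"
proof -
  let ?A = "path_image ga" and ?B = "path_image gb" and ?C = "path_image gc"
  have ends: "a \<in> ?A" "b \<in> ?B" "c \<in> ?C"
    "pathfinish ga \<in> ?A" "pathfinish gb \<in> ?B" "pathfinish gc \<in> ?C"
    using start pathstart_in_path_image pathfinish_in_path_image by metis+
  have pcA: "path_connected ?A" "path_connected ?B" "path_connected ?C"
    using arcs by (auto intro: path_connected_path_image arc_imp_path)
  have pc1: "path_connected ((Y \<union> ?A) \<union> ?B)" and pc2: "path_connected (Y \<union> ?C)"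
    using Y pcA finish ends by (auto intro!: path_connected_Un)
  have "a \<noteq> b" using notin ends by auto
  then obtain g where g: "arc g" "path_image g \<subseteq> (Y \<union> ?A) \<union> ?B" "pathstart g = a" "pathfinish g = b"
    using pc1 ends unfolding path_connected_arcwise by (metis UnCI)
  have g0: "g 0 = a" "g 1 = b" using g by (auto simp: pathstart_def pathfinish_def)
  \<comment> \<open>Otherwise \<open>?A\<close> and \<open>Y \<union> ?B\<close> would split
    \<open>g\<close> into two disjoint closed pieces, as by \<open>meet\<close> they overlap only in
    \<open>Y\<close>.\<close>
  have "path_image g \<inter> Y \<noteq> {}"
  proof
    assume "path_image g \<inter> Y = {}"
    then have "?A \<inter> (Y \<union> ?B) \<inter> path_image g = {}" using meet by auto
    moreover have "closed ?A" "closed (Y \<union> ?B)" using arcs Y by (auto simp: closed_arc_image)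
    moreover have "a \<in> ?A \<inter> path_image g" "b \<in> (Y \<union> ?B) \<inter> path_image g"
      using g ends by (auto simp: pathstart_def pathfinish_def path_image_def)
    moreover have "connected (path_image g)" using g by (simp add: connected_arc_image)
    ultimately show False
      using g(2) unfolding connected_closed by blast
  qed
  then obtain z where z: "z \<in> path_image g" "z \<in> Y" by auto
  have "c \<noteq> z" using notin z by auto
  then obtain k where k: "arc k" "path_image k \<subseteq> Y \<union> ?C" "pathstart k = c" "pathfinish k = z"
    using pc2 ends z unfolding path_connected_arcwise by (metis UnCI)
  have "open (- path_image g)" using g by (simp add: closed_arc_image open_Compl)
  then have int: "interior (- path_image g) = - path_image g" by (simp add: interior_open)
  \<comment> \<open>\<open>k u\<close> is the first point of \<open>k\<close> on \<open>g\<close>;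
    it becomes the centre.\<close>
  obtain u where u: "0 \<le> u" "u \<le> 1" "\<And>x. 0 \<le> x \<and> x < u \<Longrightarrow> k x \<notin> path_image g" "k u \<in> path_image g"
    using subpath_to_frontier_explicit[OF arc_imp_path[OF k(1)], of "- path_image g"] k(4) z(1)
    unfolding int by (metis ComplD ComplI)
  have "c \<notin> path_image g" using g(2) notin by auto
  then have "u \<noteq> 0" using u(4) k(3) by (auto simp: pathstart_def)
  obtain s where s: "0 \<le> s" "s \<le> 1" "g s = k u" using u(4) by (auto simp: path_image_def)
  have "k u \<in> path_image k" using u by (auto simp: path_image_def)
  then have "k u \<in> Y \<union> ?C" using k(2) by auto
  \<comment> \<open>The centre differs from all three feet, so none of the three subpaths
    degenerates to a point.\<close>
  then have "k u \<noteq> a" "k u \<noteq> b" using notin by auto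
  then have "s \<noteq> 0" "s \<noteq> 1" using s g0 by auto
  let ?ha = "subpath s 0 g" and ?hb = "subpath s 1 g" and ?hc = "subpath u 0 k"
  have inj: "inj_on g {0..1}" using g(1) by (simp add: arc_def)
  have im: "path_image ?ha = g ` {0..s}" "path_image ?hb = g ` {s..1}" "path_image ?hc = k ` {0..u}"
    using s u \<open>s \<noteq> 0\<close> \<open>u \<noteq> 0\<close> by (auto simp: path_image_subpath)
  have "g ` {0..s} \<inter> g ` {s..1} = g ` ({0..s} \<inter> {s..1})"
    by (rule inj_on_image_Int[OF inj, symmetric]) (use s in auto)
  also have "{0..s} \<inter> {s..1} = {s}" using s by auto
  finally have i1: "path_image ?ha \<inter> path_image ?hb = {k u}" using im s by simp
  have kc: "x = k u" if "x \<in> path_image g" "x \<in> k ` {0..u}" for x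
    using that u(3) by (metis atLeastAtMost_iff imageE less_eq_real_def)
  have sub: "g ` {0..s} \<subseteq> path_image g" "g ` {s..1} \<subseteq> path_image g" "k ` {0..u} \<subseteq> path_image k"
    using s u by (auto simp: path_image_def)
  have mem: "k u \<in> g ` {0..s}" "k u \<in> g ` {s..1}" "k u \<in> k ` {0..u}"
    using s u by (auto simp: image_iff intro: bexI[of _ s])
  have i2: "path_image ?ha \<inter> path_image ?hc = {k u}" "path_image ?hb \<inter> path_image ?hc = {k u}"
    unfolding im using kc sub mem by blast+
  have arcs': "arc ?ha" "arc ?hb" "arc ?hc"
    using s u \<open>s \<noteq> 0\<close> \<open>s \<noteq> 1\<close> \<open>u \<noteq> 0\<close> g(1) k(1) by (auto intro!: arc_subpath_arc)
  have subset: "path_image ?ha \<union> path_image ?hb \<union> path_image ?hc \<subseteq> Y \<union> ?A \<union> ?B \<union> ?C"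
    unfolding im using sub g(2) k(2) by blast
  show ?thesis
    unfolding contains_tripod_def
    by (rule exI[of _ "k u"], rule exI[of _ ?ha], rule exI[of _ ?hb], rule exI[of _ ?hc])
      (use arcs' subset i1 i2 s(3) g0 k(3)[unfolded pathstart_def] in simp)
qed

text \<open>Glued at their common feet, the two tripods form a theta curve with branch points
  \<open>p\<close> and \<open>q\<close> and one foot inside each arc. The set \<open>Z\<close> plays
  the remaining vertex of K33 with its edges, and \<open>theta_curve_no_common_face\<close> excludes
  it.\<close>

lemma no_plane_K33:
  assumes "contains_tripod X a b c" "contains_tripod Y a b c" "X \<inter> Y \<subseteq> {a, b, c}"
    and Z: "connected Z" "Z \<inter> (X \<union> Y) = {}" "a \<in> closure Z" "b \<in> closure Z" "c \<in> closure Z"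
  shows False
proof -
  obtain p ga gb gc where g: "arc ga" "arc gb" "arc gc"
     "pathstart ga = p" "pathstart gb = p" "pathstart gc = p"
     "pathfinish ga = a" "pathfinish gb = b" "pathfinish gc = c"
     "path_image ga \<inter> path_image gb = {p}" "path_image ga \<inter> path_image gc = {p}"
     "path_image gb \<inter> path_image gc = {p}"
     "path_image ga \<union> path_image gb \<union> path_image gc \<subseteq> X"
    using assms(1) unfolding contains_tripod_def by auto
  obtain q ha hb hc where h: "arc ha" "arc hb" "arc hc"
     "pathstart ha = q" "pathstart hb = q" "pathstart hc = q"
     "pathfinish ha = a" "pathfinish hb = b" "pathfinish hc = c"
     "path_image ha \<inter> path_image hb = {q}" "path_image ha \<inter> path_image hc = {q}"
     "path_image hb \<inter> path_image hc = {q}"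
     "path_image ha \<union> path_image hb \<union> path_image hc \<subseteq> Y"
    using assms(2) unfolding contains_tripod_def by auto
  have ne: "p \<noteq> a" "p \<noteq> b" "p \<noteq> c" "q \<noteq> a" "q \<noteq> b" "q \<noteq> c"
    using arc_distinct_ends g h by metis+
  have ends: "a \<in> path_image ga" "b \<in> path_image gb" "c \<in> path_image gc"
    "a \<in> path_image ha" "b \<in> path_image hb" "c \<in> path_image hc"
    using g h pathfinish_in_path_image by metis+
  have aux: "x \<notin> T" if "x \<in> S" "S \<inter> T = {r} \<or> T \<inter> S = {r}" "r \<noteq> x"
    for x r :: complex and S T
    using that by auto
  have notin: "b \<notin> path_image ga" "c \<notin> path_image ga" "a \<notin> path_image gb"
    "c \<notin> path_image gb" "a \<notin> path_image gc" "b \<notin> path_image gc"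
    by (fact aux[OF ends(2) g(10)[THEN disjI2] ne(2)]
      aux[OF ends(3) g(11)[THEN disjI2] ne(3)]
      aux[OF ends(1) g(10)[THEN disjI1] ne(1)]
      aux[OF ends(3) g(12)[THEN disjI2] ne(3)]
      aux[OF ends(1) g(11)[THEN disjI1] ne(1)]
      aux[OF ends(2) g(12)[THEN disjI1] ne(2)])+
  have notin': "b \<notin> path_image ha" "c \<notin> path_image ha" "a \<notin> path_image hb"
    "c \<notin> path_image hb" "a \<notin> path_image hc" "b \<notin> path_image hc"
    by (fact aux[OF ends(5) h(10)[THEN disjI2] ne(5)]
      aux[OF ends(6) h(11)[THEN disjI2] ne(6)]
      aux[OF ends(4) h(10)[THEN disjI1] ne(4)]
      aux[OF ends(6) h(12)[THEN disjI2] ne(6)]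
      aux[OF ends(4) h(11)[THEN disjI1] ne(4)]
      aux[OF ends(5) h(12)[THEN disjI1] ne(5)])+
  have XY: "S \<inter> T \<subseteq> {a, b, c}" if "S \<subseteq> X" "T \<subseteq> Y" for S T
    using that assms(3) by auto
  have sub: "path_image ga \<subseteq> X" "path_image gb \<subseteq> X" "path_image gc \<subseteq> X"
    "path_image ha \<subseteq> Y" "path_image hb \<subseteq> Y" "path_image hc \<subseteq> Y"
    using g(13) h(13) by auto
  let ?A = "ga +++ reversepath ha" and ?B = "gb +++ reversepath hb" and ?C = "gc +++ reversepath hc"
  have im: "path_image ?A = path_image ga \<union> path_image ha" "path_image ?B = path_image gb \<union> path_image hb"
    "path_image ?C = path_image gc \<union> path_image hc"
    using g h by (auto simp: path_image_join)
  have "path_image ga \<inter> path_image ha \<subseteq> {a}"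
    using XY[OF sub(1,4)] notin(1,2) by auto
  moreover have "path_image gb \<inter> path_image hb \<subseteq> {b}"
    using XY[OF sub(2,5)] notin(3,4) by auto
  moreover have "path_image gc \<inter> path_image hc \<subseteq> {c}"
    using XY[OF sub(3,6)] notin(5,6) by auto
  ultimately have arcs: "arc ?A" "arc ?B" "arc ?C"
    using g(1-9) h(1-9) by (simp_all add: arc_join arc_reversepath)
  have cross: "path_image ga \<inter> path_image hb = {}" "path_image ga \<inter> path_image hc = {}"
    "path_image gb \<inter> path_image ha = {}" "path_image gb \<inter> path_image hc = {}"
    "path_image gc \<inter> path_image ha = {}" "path_image gc \<inter> path_image hb = {}"
    using XY[OF sub(1,5)] XY[OF sub(1,6)] XY[OF sub(2,4)] XY[OF sub(2,6)] XY[OF sub(3,4)]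
      XY[OF sub(3,5)] notin notin' by auto
  have meet: "path_image ?A \<inter> path_image ?B \<subseteq> {p, q}" "path_image ?A \<inter> path_image ?C \<subseteq> {p, q}"
    "path_image ?B \<inter> path_image ?C \<subseteq> {p, q}"
    unfolding im using cross g(10-12) h(10-12) by auto
  show False
  proof (rule theta_curve_no_common_face[OF arcs _ _ _ _ _ _ meet _ _ _ Z(1) _ Z(3-5)])
    show "Z \<inter> (path_image ?A \<union> path_image ?B \<union> path_image ?C) = {}"
      using Z(2) g(13) h(13) unfolding im by blast
  qed (use g h im ends ne in auto)
qed

section \<open>Connected sets with dense neighbourhoods\<close>

definition nbrs :: "'a set set \<Rightarrow> 'a set \<Rightarrow> 'a \<Rightarrow> 'a set" where
  "nbrs E S v = {w \<in> S. {v, w} \<in> E}"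

text \<open>For loop-free \<open>E\<close> this is twice the number of edges inside
  \<open>S\<close>, so a bound \<open>2 * k * card S\<close> means \<open>k\<close> edges per
  vertex.\<close>

definition degree_sum :: "'a set set \<Rightarrow> 'a set \<Rightarrow> nat" where
  "degree_sum E S = (\<Sum>v\<in>S. card (nbrs E S v))"

text \<open>Connectedness as growth along one edge at a time, so that a drawing of the set can be
  assembled by induction.\<close>

inductive connected_vertices :: "'a set set \<Rightarrow> 'a set \<Rightarrow> bool" for E where
  singleton: "connected_vertices E {v}"
| extend: "connected_vertices E U \<Longrightarrow> u \<in> U \<Longrightarrow> {u, w} \<in> E \<Longrightarrow> connected_vertices E (insert w U)"

lemma connected_vertices_nonempty: "connected_vertices E U \<Longrightarrow> U \<noteq> {}"
  by (induction rule: connected_vertices.induct) auto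

lemma finite_nbrs [simp]: "finite S \<Longrightarrow> finite (nbrs E S v)"
  by (simp add: nbrs_def)

lemma degree_sum_remove:
  assumes "finite T" "w \<in> T" and loopfree: "\<And>v. {v} \<notin> E"
  shows "degree_sum E T = degree_sum E (T - {w}) + 2 * card (nbrs E T w)"
proof -
  let ?T = "T - {w}"
  have "card (nbrs E T v) = card (nbrs E ?T v) + (if {v, w} \<in> E then 1 else 0)" if "v \<in> ?T" for v
  proof -
    have "nbrs E T v = nbrs E ?T v \<union> (if {v, w} \<in> E then {w} else {})"
      using assms(2) by (auto simp: nbrs_def)
    moreover have "w \<notin> nbrs E ?T v" by (simp add: nbrs_def)
    ultimately show ?thesis using assms(1) by simp
  qed
  then have "(\<Sum>v\<in>?T. card (nbrs E T v)) = degree_sum E ?T + (\<Sum>v\<in>?T. if {v, w} \<in> E then 1 else 0)"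
    by (simp add: degree_sum_def sum.distrib)
  also have "(\<Sum>v\<in>?T. if {v, w} \<in> E then 1 else 0) = card {v \<in> ?T. {v, w} \<in> E}"
    using assms(1) by (simp add: sum.If_cases Int_def)
  also have "{v \<in> ?T. {v, w} \<in> E} = nbrs E T w"
    using loopfree by (auto simp: nbrs_def insert_commute)
  finally show ?thesis
    using assms(1,2) by (simp add: degree_sum_def sum.remove)
qed

text \<open>Contract a connected set as long as the contracted graph stays dense: for a maximal such set,
  every further contraction must destroy many edges, that is, close many triangles.\<close>

lemma dense_neighbourhood_of_connected_set:
  assumes "finite S" "S \<noteq> {}" "degree_sum E S \<ge> 2 * k * card S" "k > 0" and loopfree: "\<And>v. {v} \<notin> E"
  shows "\<exists>U M. connected_vertices E U \<and> U \<subseteq> S \<and> M \<subseteq> S \<and> U \<inter> M = {} \<and> M \<noteq> {} \<and>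
    (\<forall>w\<in>M. (\<exists>u\<in>U. {u, w} \<in> E) \<and> k \<le> card (nbrs E M w))"
  using assms(1-3)
proof (induction S rule: finite_psubset_induct)
  case (psubset S)
  define N where "N U = {w \<in> S - U. \<exists>u\<in>U. {u, w} \<in> E}" for U
  \<comment> \<open>Contract \<open>U\<close> in the graph on \<open>S\<close> and merge parallel
    edges. The result has \<open>card S + 1 - card U\<close> vertices, and twice its number of edges
    is \<open>degree_sum E (S - U) + 2 * card (N U)\<close>. Thus \<open>P U\<close> says that it
    still has at least \<open>k\<close> edges per vertex; for a singleton \<open>U\<close> it is the
    graph on \<open>S\<close> itself.\<close>
  define P where "P U \<longleftrightarrow> connected_vertices E U \<and> U \<subseteq> S \<and>
    degree_sum E (S - U) + 2 * card (N U) + 2 * k * card U \<ge> 2 * k * (card S + 1)" for U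
  obtain v where v: "v \<in> S" using psubset.prems by auto
  have "N {v} = nbrs E S v" using loopfree by (auto simp: N_def nbrs_def)
  then have "P {v}"
    using psubset.prems(2) degree_sum_remove[OF \<open>finite S\<close> v loopfree] v
    by (auto simp: P_def connected_vertices.singleton)
  moreover have "\<forall>U. P U \<longrightarrow> card U < Suc (card S)"
    using \<open>finite S\<close> by (auto simp: P_def less_Suc_eq_le intro: card_mono)
  ultimately obtain U where U: "P U" and maximal: "\<And>U'. P U' \<Longrightarrow> card U' \<le> card U"
    using ex_has_greatest_nat[of P "{v}" card "Suc (card S)"] by (metis less_imp_le_nat)
  have US: "U \<subseteq> S" "connected_vertices E U" "finite U" using U \<open>finite S\<close> finite_subset by (auto simp: P_def)
  have cS: "card (S - U) + card U = card S"
    using US \<open>finite S\<close> by (simp add: card_Diff_subset card_mono)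
  have fN: "finite (N U)" using \<open>finite S\<close> by (simp add: N_def)
  show ?case
  proof (cases "N U = {}")
    \<comment> \<open>A set \<open>U\<close> without outside neighbours contributes no edges to the
      contracted graph, so the smaller set \<open>S - U\<close> is itself dense and the induction
      hypothesis applies.\<close>
    case True
    have "2 * k * card (S - U) + 2 * k * card U = 2 * k * card S"
      using cS by (metis add_mult_distrib2)
    then have D: "degree_sum E (S - U) \<ge> 2 * k * card (S - U) + 2 * k"
      using U True by (simp add: P_def)
    then have "degree_sum E (S - U) \<noteq> 0" using \<open>k > 0\<close> by simp
    then have "S - U \<noteq> {}" unfolding degree_sum_def by (metis sum.empty)
    moreover have "S - U \<subset> S" using US connected_vertices_nonempty[OF US(2)] by auto
    ultimately obtain U' M where UM: "connected_vertices E U' \<and> U' \<subseteq> S - U \<and> M \<subseteq> S - U \<and> U' \<inter> M = {} \<and> M \<noteq> {} \<and>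
      (\<forall>w\<in>M. (\<exists>u\<in>U'. {u, w} \<in> E) \<and> k \<le> card (nbrs E M w))"
      using psubset.IH[of "S - U"] D by auto
    then have "U' \<subseteq> S" "M \<subseteq> S" by auto
    with UM show ?thesis by (metis)
  next
    case False
    \<comment> \<open>Contracting \<open>w\<close> as well removes one vertex, the edge from
      \<open>w\<close> to \<open>U\<close>, and one edge for each neighbour of \<open>w\<close> in
      \<open>N U\<close>. By maximality this destroys density, so more than \<open>k\<close> edges
      are lost, at least \<open>k\<close> of them through neighbours in \<open>N U\<close>.\<close>
    have min_degree: "k \<le> card (nbrs E (N U) w)" if w: "w \<in> N U" for w
    proof -
      let ?U = "insert w U"
      obtain u where u: "u \<in> U" "{u, w} \<in> E" and wS: "w \<in> S - U" using w by (auto simp: N_def)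
      have cU: "card ?U = Suc (card U)" using US wS by auto
      then have "\<not> P ?U" using maximal[of ?U] by auto
      moreover have "connected_vertices E ?U" using US u by (auto intro: connected_vertices.extend)
      ultimately have lt: "degree_sum E (S - ?U) + 2 * card (N ?U) + 2 * k * card ?U < 2 * k * (card S + 1)"
        using US wS by (auto simp: P_def)
      have "S - U - {w} = S - ?U" by auto
      then have ds: "degree_sum E (S - U) = degree_sum E (S - ?U) + 2 * card (nbrs E (S - U) w)"
        using degree_sum_remove[of "S - U" w E] wS \<open>finite S\<close> loopfree by simp
      have "N ?U = (N U - {w}) \<union> (nbrs E (S - U) w - N U)"
        using loopfree wS by (auto simp: N_def nbrs_def)
      then have "card (N ?U) = card (N U - {w}) + card (nbrs E (S - U) w - N U)"
        using fN \<open>finite S\<close> by (subst card_Un_disjoint[symmetric]) auto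
      moreover have "card (N U - {w}) + 1 = card (N U)"
        using fN w by (metis Suc_eq_plus1 card_Suc_Diff1)
      moreover have "card (nbrs E (S - U) w) = card (nbrs E (N U) w) + card (nbrs E (S - U) w - N U)"
      proof -
        have "nbrs E (S - U) w = nbrs E (N U) w \<union> (nbrs E (S - U) w - N U)"
          "nbrs E (N U) w \<inter> (nbrs E (S - U) w - N U) = {}"
          by (auto simp: nbrs_def N_def)
        then show ?thesis
          using fN \<open>finite S\<close> by (metis card_Un_disjoint finite_Diff finite_nbrs)
      qed
      moreover have "degree_sum E (S - U) + 2 * card (N U) + 2 * k * card U \<ge> 2 * k * (card S + 1)"
        using U by (simp add: P_def)
      ultimately show ?thesis using lt ds unfolding cU by (simp add: algebra_simps)
    qed
    show ?thesis
      by (rule exI[of _ U], rule exI[of _ "N U"]) (use False US min_degree in \<open>auto simp: N_def\<close>)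
  qed
qed

lemma dense_neighbourhoodE:
  assumes "finite S" "S \<noteq> {}" "degree_sum E S \<ge> 2 * k * card S" "k > 0" "\<And>v. {v} \<notin> E"
  obtains U M where "connected_vertices E U" "U \<subseteq> S" "M \<subseteq> S" "U \<inter> M = {}" "M \<noteq> {}"
    "\<And>w. w \<in> M \<Longrightarrow> \<exists>u\<in>U. {u, w} \<in> E" "\<And>w. w \<in> M \<Longrightarrow> k \<le> card (nbrs E M w)"
proof -
  from dense_neighbourhood_of_connected_set[OF assms] show thesis
    by (elim exE conjE) (rule that, auto)
qed

section \<open>Plane drawings\<close>

text \<open>Without its start an arc is the image of a half-open interval. Pieces of this kind, one
  for each edge at a vertex, will form the set \<open>Z\<close> of
  \<open>no_plane_K33\<close>.\<close>

lemma arc_minus_start: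
  fixes g :: "real \<Rightarrow> complex"
  assumes "arc g"
  shows "connected (path_image g - {pathstart g})" "pathstart g \<in> closure (path_image g - {pathstart g})"
proof -
  have inj: "inj_on g {0..1}" and cont: "continuous_on {0..1} g"
    using assms by (auto simp: arc_def path_def)
  have eq: "path_image g - {pathstart g} = g ` {0<..1}"
  proof -
    have "g x \<noteq> g 0" if "0 < x" "x \<le> 1" for x
      using inj_onD[OF inj, of x 0] that by auto
    then show ?thesis
      by (force simp: path_image_def pathstart_def less_eq_real_def)
  qed
  show "connected (path_image g - {pathstart g})"
    unfolding eq by (intro connected_continuous_image continuous_on_subset[OF cont]) auto
  have "g ` closure {0<..1} \<subseteq> closure (g ` {0<..1})"
    by (rule image_closure_subset) (use cont closure_subset[of "g ` {0<..1}"] in \<open>auto simp: closure_greaterThanAtMost\<close>)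
  then show "pathstart g \<in> closure (path_image g - {pathstart g})"
    unfolding eq by (simp add: pathstart_def closure_greaterThanAtMost image_subset_iff)
qed

locale plane_drawing =
  fixes n :: nat and E :: "nat set set" and p :: "nat \<Rightarrow> complex" and \<gamma> :: "nat set \<Rightarrow> real \<Rightarrow> complex"
  assumes simple: "simple_graph n E"
    and inj: "inj_on p {0..<n}"
    and drawn: "\<And>u v. {u, v} \<in> E \<Longrightarrow> u < v \<Longrightarrow>
        arc (\<gamma> {u, v}) \<and> pathstart (\<gamma> {u, v}) = p u \<and> pathfinish (\<gamma> {u, v}) = p v \<and>
        path_image (\<gamma> {u, v}) \<inter> p ` {0..<n} = {p u, p v}"
    and crossing_free: "\<And>e e'. e \<in> E \<Longrightarrow> e' \<in> E \<Longrightarrow> e \<noteq> e' \<Longrightarrow>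
        path_image (\<gamma> e) \<inter> path_image (\<gamma> e') \<subseteq> p ` (e \<inter> e')"
begin

lemma edge_vertices:
  assumes "{u, v} \<in> E"
  shows "u \<noteq> v" "u < n" "v < n"
proof -
  obtain a b where "a \<noteq> b" "a < n" "b < n" "{u, v} = {a, b}"
    using assms simple unfolding simple_graph_def by blast
  then show "u \<noteq> v" "u < n" "v < n" by (auto simp: doubleton_eq_iff)
qed

lemma edge_bound:
  assumes "e \<in> E" "s \<in> e"
  shows "s < n"
proof -
  obtain a b where "a < n" "b < n" "e = {a, b}"
    using assms(1) simple unfolding simple_graph_def by blast
  then show ?thesis using assms(2) by auto
qed

lemma edge_vertices_on:
  assumes "e \<in> E"
  shows "path_image (\<gamma> e) \<inter> p ` {0..<n} = p ` e"
proof -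
  obtain a b where "a \<noteq> b" "e = {a, b}"
    using assms simple unfolding simple_graph_def by blast
  then show ?thesis
    using drawn[of a b] drawn[of b a] assms by (cases a b rule: linorder_cases) (auto simp: insert_commute)
qed

text \<open>A drawing orients each edge from its smaller to its larger end; reversing the path gives
  the other direction, so later arguments need not compare vertex numbers.\<close>

lemma edge_arc:
  assumes "{u, v} \<in> E"
  obtains g where "arc g" "pathstart g = p u" "pathfinish g = p v" "path_image g = path_image (\<gamma> {u, v})"
proof (cases "u < v")
  case True
  then show thesis using drawn[OF assms] that by blast
next
  case False
  then have "v < u" using edge_vertices[OF assms] by simp
  then show thesis
    using drawn[of v u] assms that[of "reversepath (\<gamma> {u, v})"]
    by (simp add: insert_commute arc_reversepath)
qed

text \<open>The vertex set is recorded apart from the edges because a one-vertex subgraph has no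
  edge that would carry its point.\<close>

definition img :: "nat set set \<Rightarrow> nat set \<Rightarrow> complex set" where
  "img F W = (\<Union>e\<in>F. path_image (\<gamma> e)) \<union> p ` W"

lemma vertex_in_img:
  assumes "F \<subseteq> E" "W \<subseteq> {0..<n}" "t < n" "p t \<in> img F W"
  shows "t \<in> \<Union>F \<union> W"
proof -
  have eq: "t = s" if "p t = p s" "s < n" for s
    using inj assms(3) that by (auto simp: inj_on_def)
  have bound: "s < n" if "s \<in> e" "e \<in> F" for s e
    using edge_bound[OF _ that(1)] that(2) assms(1) by auto
  show ?thesis
    using assms(4) unfolding img_def
  proof
    assume "p t \<in> (\<Union>e\<in>F. path_image (\<gamma> e))"
    then obtain e where e: "e \<in> F" "p t \<in> path_image (\<gamma> e)" by auto
    then have "p t \<in> p ` e" using edge_vertices_on[of e] assms(1,3) by fastforce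
    then show ?thesis using e eq bound by auto
  next
    assume "p t \<in> p ` W"
    then show ?thesis using eq assms(2) by auto
  qed
qed

lemma img_Int:
  assumes "F \<subseteq> E" "F' \<subseteq> E" "F \<inter> F' = {}" "W \<subseteq> {0..<n}" "W' \<subseteq> {0..<n}"
  shows "img F W \<inter> img F' W' \<subseteq> p ` ((\<Union>F \<union> W) \<inter> (\<Union>F' \<union> W'))"
proof
  fix x assume x: "x \<in> img F W \<inter> img F' W'"
  show "x \<in> p ` ((\<Union>F \<union> W) \<inter> (\<Union>F' \<union> W'))"
  proof (cases "x \<in> p ` {0..<n}")
    case True
    then show ?thesis using x vertex_in_img assms by fastforce
  next
    case False
    then obtain e e' where "e \<in> F" "x \<in> path_image (\<gamma> e)" "e' \<in> F'" "x \<in> path_image (\<gamma> e')"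
      using x assms(4,5) by (auto simp: img_def)
    moreover then have "e \<noteq> e'" using assms(3) by auto
    ultimately show ?thesis using crossing_free[of e e'] assms(1,2) by blast
  qed
qed

lemma connected_vertices_drawing:
  assumes "connected_vertices E U" "U \<subseteq> {0..<n}"
  shows "\<exists>F\<subseteq>E. (\<forall>e\<in>F. e \<subseteq> U) \<and> closed (img F U) \<and> path_connected (img F U)"
  using assms
proof (induction rule: connected_vertices.induct)
  case (singleton v)
  show ?case by (rule exI[of _ "{}"]) (simp add: img_def)
next
  case (extend U u w)
  then obtain F where F: "F \<subseteq> E" "\<forall>e\<in>F. e \<subseteq> U" "closed (img F U)" "path_connected (img F U)" by auto
  obtain g where g: "arc g" "pathstart g = p u" "pathfinish g = p w" "path_image g = path_image (\<gamma> {u, w})"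
    using edge_arc[OF extend.hyps(3)] by blast
  have ends: "p u \<in> path_image g" "p w \<in> path_image g"
    using g pathstart_in_path_image pathfinish_in_path_image by metis+
  have eq: "img (insert {u, w} F) (insert w U) = img F U \<union> path_image g"
    using ends(2) g(4) by (auto simp: img_def)
  have "closed (img F U \<union> path_image g)" using F(3) closed_arc_image[OF g(1)] by (rule closed_Un)
  moreover have "path_connected (img F U \<union> path_image g)"
  proof (rule path_connected_Un)
    show "path_connected (path_image g)" using g(1) by (simp add: path_connected_path_image arc_imp_path)
    show "img F U \<inter> path_image g \<noteq> {}" using ends(1) extend.hyps(2) by (auto simp: img_def)
  qed (rule F(4))
  ultimately show ?case
    using F extend.hyps eq by (intro exI[of _ "insert {u, w} F"]) auto
qed

text \<open>The drawing of \<open>U\<close> is the hub \<open>Y\<close> of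
  \<open>contains_tripodI\<close>, and one edge to each of \<open>a\<close>, \<open>b\<close>,
  \<open>c\<close> is a leg. That every edge of \<open>F\<close> touches \<open>U\<close> makes the
  edge sets belonging to disjoint branch sets disjoint.\<close>

lemma branch_tripod:
  assumes U: "connected_vertices E U" "U \<subseteq> {0..<n}"
    and notin: "a \<notin> U" "b \<notin> U" "c \<notin> U" "a \<noteq> b" "a \<noteq> c" "b \<noteq> c"
    and adj: "\<exists>u\<in>U. {a, u} \<in> E" "\<exists>u\<in>U. {b, u} \<in> E" "\<exists>u\<in>U. {c, u} \<in> E"
  obtains F where "F \<subseteq> E" "\<And>e. e \<in> F \<Longrightarrow> e \<subseteq> U \<union> {a, b, c} \<and> e \<inter> U \<noteq> {}"
    "contains_tripod (img F U) (p a) (p b) (p c)"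
proof -
  obtain F where F: "F \<subseteq> E" "\<forall>e\<in>F. e \<subseteq> U" "closed (img F U)" "path_connected (img F U)"
    using connected_vertices_drawing[OF U] by auto
  obtain a' b' c' where t: "a' \<in> U" "{a, a'} \<in> E" "b' \<in> U" "{b, b'} \<in> E" "c' \<in> U" "{c, c'} \<in> E"
    using adj by auto
  obtain ga where ga: "arc ga" "pathstart ga = p a" "pathfinish ga = p a'" "path_image ga = path_image (\<gamma> {a, a'})"
    using edge_arc[OF t(2)] by blast
  obtain gb where gb: "arc gb" "pathstart gb = p b" "pathfinish gb = p b'" "path_image gb = path_image (\<gamma> {b, b'})"
    using edge_arc[OF t(4)] by blast
  obtain gc where gc: "arc gc" "pathstart gc = p c" "pathfinish gc = p c'" "path_image gc = path_image (\<gamma> {c, c'})"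
    using edge_arc[OF t(6)] by blast
  have lt: "a < n" "b < n" "c < n" using edge_vertices t by auto
  have im: "img F U \<union> path_image g = img (insert e F) U" if "path_image g = path_image (\<gamma> e)" for g e F
    using that by (auto simp: img_def)
  let ?F = "insert {c, c'} (insert {b, b'} (insert {a, a'} F))"
  have FE: "?F \<subseteq> E" using F t by auto
  have eq: "img F U \<union> path_image ga \<union> path_image gb \<union> path_image gc = img ?F U"
    using im ga gb gc by metis
  have FU: "x \<notin> \<Union>F" if "x \<notin> U" for x using F(2) that by auto
  have a: "p a \<notin> img F U \<union> path_image gb \<union> path_image gc"
    using vertex_in_img[of "insert {c, c'} (insert {b, b'} F)" U a] F t lt U notin FU[of a] im gb(4) gc(4) by auto
  have b: "p b \<notin> img F U \<union> path_image ga \<union> path_image gc"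
    using vertex_in_img[of "insert {c, c'} (insert {a, a'} F)" U b] F t lt U notin FU[of b] im ga(4) gc(4) by auto
  have c: "p c \<notin> img F U \<union> path_image ga \<union> path_image gb"
    using vertex_in_img[of "insert {b, b'} (insert {a, a'} F)" U c] F t lt U notin FU[of c] im ga(4) gb(4) by auto
  have "{a, a'} \<noteq> {b, b'}" using notin t by (auto simp: doubleton_eq_iff)
  then have "path_image ga \<inter> path_image gb \<subseteq> p ` ({a, a'} \<inter> {b, b'})"
    unfolding ga gb using crossing_free t by blast
  also have "\<dots> \<subseteq> img F U" using notin t by (auto simp: img_def)
  finally have "path_image ga \<inter> path_image gb \<subseteq> img F U" .
  then have "contains_tripod (img F U \<union> path_image ga \<union> path_image gb \<union> path_image gc) (p a) (p b) (p c)"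
    using F ga gb gc a b c t by (intro contains_tripodI) (auto simp: img_def)
  then have "contains_tripod (img ?F U) (p a) (p b) (p c)" unfolding eq .
  moreover have "e \<subseteq> U \<union> {a, b, c} \<and> e \<inter> U \<noteq> {}" if "e \<in> ?F" for e
  proof (cases "e \<in> F")
    case True
    then have "e \<in> E" "e \<subseteq> U" using F by auto
    moreover have "e \<noteq> {}" using \<open>e \<in> E\<close> simple unfolding simple_graph_def by blast
    ultimately show ?thesis by blast
  qed (use that t in auto)
  ultimately show thesis using that FE by blast
qed

text \<open>The branch sets \<open>U\<close> and \<open>V\<close> yield two tripods with feet at
  \<open>a\<close>, \<open>b\<close>, \<open>c\<close>, which meet only there because their edges
  are distinct and do not cross. The star of \<open>v\<close> without the feet is the set
  \<open>Z\<close>.\<close>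

lemma no_K33_model:
  assumes U: "connected_vertices E U" "U \<subseteq> {0..<n}" and V: "connected_vertices E V" "V \<subseteq> {0..<n}"
    and disj: "U \<inter> V = {}" "v \<notin> U" "v \<notin> V"
    and abc: "a \<noteq> b" "a \<noteq> c" "b \<noteq> c" "{a, b, c} \<inter> (U \<union> V) = {}"
    and adj: "\<And>t. t \<in> {a, b, c} \<Longrightarrow> (\<exists>u\<in>U. {t, u} \<in> E) \<and> (\<exists>u\<in>V. {t, u} \<in> E) \<and> {t, v} \<in> E"
  shows False
proof -
  obtain F where F: "F \<subseteq> E" "\<And>e. e \<in> F \<Longrightarrow> e \<subseteq> U \<union> {a, b, c} \<and> e \<inter> U \<noteq> {}"
    "contains_tripod (img F U) (p a) (p b) (p c)"
    using branch_tripod[OF U, of a b c] abc adj by auto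
  obtain G where G: "G \<subseteq> E" "\<And>e. e \<in> G \<Longrightarrow> e \<subseteq> V \<union> {a, b, c} \<and> e \<inter> V \<noteq> {}"
    "contains_tripod (img G V) (p a) (p b) (p c)"
    using branch_tripod[OF V, of a b c] abc adj by auto
  let ?P = "{p a, p b, p c}"
  let ?H = "{{a, v}, {b, v}, {c, v}}"
  have H: "?H \<subseteq> E" using adj by auto
  have va: "a \<noteq> v" "b \<noteq> v" "c \<noteq> v" and lt: "a < n" "b < n" "c < n" using adj edge_vertices by blast+
  have "F \<inter> G = {}" using F(2) G(2) disj abc by fastforce
  then have "img F U \<inter> img G V \<subseteq> p ` ((\<Union>F \<union> U) \<inter> (\<Union>G \<union> V))"
    using img_Int F G U V by auto
  also have "\<dots> \<subseteq> ?P" using F(2) G(2) disj abc by fastforce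
  finally have FG: "img F U \<inter> img G V \<subseteq> ?P" .
  have "?H \<inter> F = {}" "?H \<inter> G = {}" using F(2) G(2) disj abc by auto
  then have "img ?H {} \<inter> img F U \<subseteq> p ` ((\<Union>?H \<union> {}) \<inter> (\<Union>F \<union> U))"
    "img ?H {} \<inter> img G V \<subseteq> p ` ((\<Union>?H \<union> {}) \<inter> (\<Union>G \<union> V))"
    using img_Int[OF H] F G U V by auto
  moreover have "(\<Union>?H \<union> {}) \<inter> (\<Union>F \<union> U) \<subseteq> {a, b, c}" "(\<Union>?H \<union> {}) \<inter> (\<Union>G \<union> V) \<subseteq> {a, b, c}"
    using F(2) G(2) disj abc by fastforce+
  ultimately have "img ?H {} \<inter> img F U \<subseteq> p ` {a, b, c}" "img ?H {} \<inter> img G V \<subseteq> p ` {a, b, c}"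
    by (meson image_mono order_trans)+
  then have HX: "(img ?H {} - ?P) \<inter> (img F U \<union> img G V) = {}" by auto
  have leg: "connected (path_image (\<gamma> {t, v}) - ?P)" "p t \<in> closure (path_image (\<gamma> {t, v}) - ?P)"
    "p v \<in> path_image (\<gamma> {t, v}) - ?P" if "t \<in> {a, b, c}" for t
  proof -
    have tv: "{t, v} \<in> E" using adj that by auto
    obtain g where g: "arc g" "pathstart g = p t" "pathfinish g = p v" "path_image g = path_image (\<gamma> {t, v})"
      using edge_arc[OF tv] by blast
    have "s = t" if "p s \<in> path_image g" "s \<in> {a, b, c}" for s
      using vertex_in_img[of "{{t, v}}" "{}" s] tv that lt va g(4) by (auto simp: img_def)
    moreover have "p t \<in> path_image g" using g(2) by (metis pathstart_in_path_image)
    ultimately have eq: "path_image (\<gamma> {t, v}) - ?P = path_image g - {pathstart g}"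
      using g(2,4) that by auto
    show "connected (path_image (\<gamma> {t, v}) - ?P)" "p t \<in> closure (path_image (\<gamma> {t, v}) - ?P)"
      unfolding eq using arc_minus_start[OF g(1)] g(2) by auto
    show "p v \<in> path_image (\<gamma> {t, v}) - ?P"
      unfolding eq using g arc_distinct_ends[OF g(1)] by (metis DiffI pathfinish_in_path_image singletonD)
  qed
  \<comment> \<open>The three legs, each without its foot, all contain \<open>p v\<close>; hence
    their union is connected while accumulating at every foot.\<close>
  define Z where "Z = (\<Union>t\<in>{a, b, c}. path_image (\<gamma> {t, v}) - ?P)"
  have "connected Z"
    unfolding Z_def
  proof (rule connected_Union)
    have "p v \<in> (\<Inter>t\<in>{a, b, c}. path_image (\<gamma> {t, v}) - ?P)"
      by (rule INT_I) (rule leg(3))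
    then show "(\<Inter>t\<in>{a, b, c}. path_image (\<gamma> {t, v}) - ?P) \<noteq> {}" by (metis empty_iff)
  qed (use leg(1) in blast)
  moreover have "p t \<in> closure Z" if "t \<in> {a, b, c}" for t
  proof -
    have "path_image (\<gamma> {t, v}) - ?P \<subseteq> Z" unfolding Z_def using that by blast
    then show ?thesis using leg(2)[OF that] closure_mono by blast
  qed
  moreover have "Z \<subseteq> img ?H {} - ?P"
    by (auto simp: Z_def img_def)
  then have "Z \<inter> (img F U \<union> img G V) = {}"
    using HX by blast
  ultimately show False
    using no_plane_K33[OF F(3) G(3) FG, of Z] by auto
qed

lemma loop_free: "{v} \<notin> E"
  by (metis edge_vertices(1) insert_absorb2)

text \<open>Three common neighbours would be the feet of a K33 model with branch sets
  \<open>{a}\<close>, \<open>{b}\<close> and the vertex \<open>c\<close>.\<close>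

lemma no_K33_subgraph:
  assumes "a \<noteq> b" "a \<noteq> c" "b \<noteq> c" "a < n" "b < n" "c < n"
  shows "card {w \<in> {0..<n}. {a, w} \<in> E \<and> {b, w} \<in> E \<and> {c, w} \<in> E} \<le> 2"
proof (rule ccontr)
  let ?W = "{w \<in> {0..<n}. {a, w} \<in> E \<and> {b, w} \<in> E \<and> {c, w} \<in> E}"
  assume "\<not> card ?W \<le> 2"
  then have "3 \<le> card ?W" by simp
  then obtain S where S: "S \<subseteq> ?W" "card S = 3"
    by (rule obtain_subset_with_card_n)
  obtain x y z where xyz: "S = {x, y, z}" "x \<noteq> y" "x \<noteq> z" "y \<noteq> z"
    using S(2) by (metis card_3_iff)
  note T = S(1)[unfolded xyz(1)] xyz(2-4)
  have adj: "{t, a} \<in> E" "{t, b} \<in> E" "{t, c} \<in> E" if "t \<in> {x, y, z}" for t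
    using T(1) that by (auto simp: insert_commute)
  have ne: "t \<noteq> a" "t \<noteq> b" if "t \<in> {x, y, z}" for t
    using adj[OF that] edge_vertices(1) by auto
  show False
  proof (rule no_K33_model[of "{a}" "{b}" c x y z])
    show "{x, y, z} \<inter> ({a} \<union> {b}) = {}" using ne by auto
    show "(\<exists>u\<in>{a}. {t, u} \<in> E) \<and> (\<exists>u\<in>{b}. {t, u} \<in> E) \<and> {t, c} \<in> E" if "t \<in> {x, y, z}" for t
      using adj[OF that] by simp
  qed (use T assms in \<open>auto intro: connected_vertices.singleton\<close>)
qed

lemma degree_sum_bound:
  assumes "S \<subseteq> {0..<n}"
  shows "degree_sum E S \<le> 12 * card S"
proof (rule ccontr)
  assume large: "\<not> degree_sum E S \<le> 12 * card S"
  then have "S \<noteq> {}" by (auto simp: degree_sum_def)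
  have "finite S" using assms finite_subset by auto
  moreover have "2 * 6 * card S \<le> degree_sum E S" using large by simp
  ultimately obtain U M where U: "connected_vertices E U" "U \<subseteq> S" and M: "M \<subseteq> S" "U \<inter> M = {}" "M \<noteq> {}"
    and MU: "\<And>w. w \<in> M \<Longrightarrow> \<exists>u\<in>U. {u, w} \<in> E" and Mw: "\<And>w. w \<in> M \<Longrightarrow> 6 \<le> card (nbrs E M w)"
    using dense_neighbourhoodE[of S 6 E] \<open>S \<noteq> {}\<close> loop_free by (metis zero_less_numeral)
  have fM: "finite M" using M \<open>finite S\<close> finite_subset by auto
  \<comment> \<open>Minimum degree \<open>6\<close> inside \<open>M\<close> is the density needed to
    repeat the argument with \<open>k = 3\<close> inside \<open>M\<close>.\<close>
  have "2 * 3 * card M = (\<Sum>w\<in>M. 6)" by simp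
  also have "\<dots> \<le> degree_sum E M" unfolding degree_sum_def by (rule sum_mono) (use Mw in auto)
  finally obtain V K where V: "connected_vertices E V" "V \<subseteq> M" and K: "K \<subseteq> M" "V \<inter> K = {}" "K \<noteq> {}"
    and KV: "\<And>w. w \<in> K \<Longrightarrow> \<exists>u\<in>V. {u, w} \<in> E" and Kw: "\<And>w. w \<in> K \<Longrightarrow> 3 \<le> card (nbrs E K w)"
    using dense_neighbourhoodE[OF fM \<open>M \<noteq> {}\<close>, of 3 E] loop_free by (metis zero_less_numeral)
  \<comment> \<open>Three neighbours of \<open>v\<close> inside \<open>K\<close> serve as feet:
    lying in \<open>K\<close> they are adjacent to \<open>V\<close>, lying in \<open>M\<close> they
    are adjacent to \<open>U\<close>.\<close>
  obtain v where v: "v \<in> K" using K by auto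
  then obtain T where "T \<subseteq> nbrs E K v" "card T = 3" using Kw[OF v] obtain_subset_with_card_n by metis
  then obtain x y z where T: "{x, y, z} \<subseteq> nbrs E K v" "x \<noteq> y" "x \<noteq> z" "y \<noteq> z"
    by (metis card_3_iff)
  then have xK: "{x, y, z} \<subseteq> K" and xv: "\<And>t. t \<in> {x, y, z} \<Longrightarrow> {t, v} \<in> E"
    by (auto simp: nbrs_def insert_commute)
  have adj: "(\<exists>u\<in>U. {t, u} \<in> E) \<and> (\<exists>u\<in>V. {t, u} \<in> E) \<and> {t, v} \<in> E" if "t \<in> {x, y, z}" for t
  proof -
    have "t \<in> K" "t \<in> M" using that xK K by auto
    then show ?thesis using KV[of t] MU[of t] xv[OF that] by (auto simp: insert_commute)
  qed
  show False
    by (rule no_K33_model[OF U(1) _ V(1) _ _ _ _ T(2-4) _ adj]) (use U V M K v xK assms in auto)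
qed

end

lemma planar_plane_drawing:
  assumes "simple_graph n E" "planar n E"
  obtains p \<gamma> where "plane_drawing n E p \<gamma>"
proof -
  from assms(2)[unfolded planar_def] show thesis
  proof (elim exE conjE)
    fix p :: "nat \<Rightarrow> complex" and \<gamma> :: "nat set \<Rightarrow> real \<Rightarrow> complex"
    assume "inj_on p {0..<n}" and
      drawn: "\<forall>u v. {u, v} \<in> E \<longrightarrow> u < v \<longrightarrow>
        arc (\<gamma> {u, v}) \<and> pathstart (\<gamma> {u, v}) = p u \<and> pathfinish (\<gamma> {u, v}) = p v \<and>
        path_image (\<gamma> {u, v}) \<inter> p ` {0..<n} = {p u, p v}" and
      crossing_free: "\<forall>e\<in>E. \<forall>e'\<in>E. e \<noteq> e' \<longrightarrow> path_image (\<gamma> e) \<inter> path_image (\<gamma> e') \<subseteq> p ` (e \<inter> e')"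
    show thesis
    proof (rule that[of p \<gamma>], unfold_locales)
      show "arc (\<gamma> {u, v}) \<and> pathstart (\<gamma> {u, v}) = p u \<and> pathfinish (\<gamma> {u, v}) = p v \<and>
        path_image (\<gamma> {u, v}) \<inter> p ` {0..<n} = {p u, p v}" if "{u, v} \<in> E" "u < v" for u v
        by (rule drawn[rule_format, OF that])
      show "path_image (\<gamma> e) \<inter> path_image (\<gamma> e') \<subseteq> p ` (e \<inter> e')" if "e \<in> E" "e' \<in> E" "e \<noteq> e'" for e e'
        by (rule crossing_free[rule_format, OF that])
    qed fact+
  qed
qed

section \<open>Subinvariant vectors\<close>

lemma sum_card_filter_swap:
  assumes "finite A" "finite B"
  shows "(\<Sum>a\<in>A. card {b \<in> B. P a b}) = (\<Sum>b\<in>B. card {a \<in> A. P a b})"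
proof -
  have "card {b \<in> B. P a b} = (\<Sum>b\<in>B. if P a b then 1 else 0)" for a
    using assms(2) by (simp add: sum.If_cases Int_def)
  moreover have "card {a \<in> A. P a b} = (\<Sum>a\<in>A. if P a b then 1 else 0)" for b
    using assms(1) by (simp add: sum.If_cases Int_def)
  ultimately show ?thesis by (simp add: sum.swap[of _ A B])
qed

lemma sum_nbrs_swap:
  assumes "finite A" "finite B"
  shows "(\<Sum>a\<in>A. card (nbrs E B a)) = (\<Sum>b\<in>B. card (nbrs E A b))"
  unfolding nbrs_def using sum_card_filter_swap[OF assms, of "\<lambda>a b. {a, b} \<in> E"]
  by (simp add: insert_commute)

text \<open>The setting of the counting argument. Planarity survives only through
  \<open>K33_free\<close> and \<open>sparse\<close>; \<open>lam_large\<close> will come from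
  comparison with \<open>K2n\<close>.\<close>

locale large_subinvariant =
  fixes n :: nat and E :: "nat set set" and x :: "nat \<Rightarrow> real" and lam :: real and u :: nat
  assumes n_large: "real n \<ge> 2.16 * 10 ^ 17"
    and loop_free: "\<And>v. {v} \<notin> E"
    and C3C3_free: "\<not> contains_C3C3 E"
    and K33_free: "\<And>a b c. a \<noteq> b \<Longrightarrow> a \<noteq> c \<Longrightarrow> b \<noteq> c \<Longrightarrow> a < n \<Longrightarrow> b < n \<Longrightarrow> c < n \<Longrightarrow>
      card {w \<in> {0..<n}. {a, w} \<in> E \<and> {b, w} \<in> E \<and> {c, w} \<in> E} \<le> 2"
    and sparse: "\<And>S. S \<subseteq> {0..<n} \<Longrightarrow> degree_sum E S \<le> 12 * card S"
    and x_nonneg: "\<And>v. v < n \<Longrightarrow> 0 \<le> x v" and x_le_1: "\<And>v. v < n \<Longrightarrow> x v \<le> 1"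
    and u: "u < n" "x u = 1"
    and lam_nonneg: "0 \<le> lam" and lam_large: "2 * (real n - 2) \<le> lam\<^sup>2"
    and subinvariant: "\<And>v. v < n \<Longrightarrow> lam * x v \<le> (\<Sum>w\<in>nbrs E {0..<n} v. x w)"
begin

abbreviation "V \<equiv> {0..<n}"
abbreviation "N v \<equiv> nbrs E V v"
abbreviation "deg v \<equiv> card (N v)"

section \<open>Walk counts and vertices with large entries\<close>

lemma nbrs_subset: "nbrs E S v \<subseteq> S"
  by (auto simp: nbrs_def)

lemma in_N: "w \<in> N v \<longleftrightarrow> w < n \<and> {v, w} \<in> E"
  by (auto simp: nbrs_def)

lemma deg_le: "deg v \<le> n"
  using card_mono[OF _ nbrs_subset[of V v]] by simp

text \<open>The square of \<open>6.5 * 10 ^ 8\<close> is \<open>4.225 * 10 ^ 17\<close>, below the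
  \<open>4.32 * 10 ^ 17 - 4\<close> that \<open>2 * (n - 2)\<close> reaches at least.\<close>

lemma lam_ge: "lam \<ge> 6.5 * 10 ^ 8"
proof (rule ccontr)
  assume "\<not> lam \<ge> 6.5 * 10 ^ 8"
  then have "lam\<^sup>2 \<le> (6.5 * 10 ^ 8)\<^sup>2" using lam_nonneg by (intro power_mono) auto
  then show False using lam_large n_large by (simp add: power2_eq_square)
qed

lemma sum_deg_le:
  assumes "S \<subseteq> V"
  shows "real (\<Sum>v\<in>S. deg v) \<le> 12 * real n"
proof -
  have "(\<Sum>v\<in>S. deg v) \<le> degree_sum E V"
    unfolding degree_sum_def by (rule sum_mono2) (use assms in auto)
  also have "\<dots> \<le> 12 * n" using sparse[of V] by simp
  finally show ?thesis by linarith
qed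

lemma cross_le:
  assumes "S \<subseteq> V" "T \<subseteq> V"
  shows "(\<Sum>y\<in>S. card (nbrs E T y)) \<le> 12 * (card S + card T)"
proof -
  have f: "finite S" "finite T" using assms finite_subset by auto
  have "(\<Sum>y\<in>S. card (nbrs E T y)) \<le> (\<Sum>y\<in>S. card (nbrs E (S \<union> T) y))"
    by (intro sum_mono card_mono) (use f in \<open>auto simp: nbrs_def\<close>)
  also have "\<dots> \<le> degree_sum E (S \<union> T)"
    unfolding degree_sum_def by (rule sum_mono2) (use f in auto)
  also have "\<dots> \<le> 12 * card (S \<union> T)" using sparse[of "S \<union> T"] assms by auto
  also have "\<dots> \<le> 12 * (card S + card T)" using card_Un_le[of S T] by simp
  finally show ?thesis .
qed

lemma sum_x_le:
  assumes "\<And>w. w \<in> S \<Longrightarrow> x w \<le> M"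
  shows "(\<Sum>w\<in>S. x w) \<le> M * real (card S)"
  using sum_bounded_above[of S x M] assms by (simp add: mult.commute)

text \<open>Summing subinvariance over all vertices and using that entries are at most
  \<open>1\<close> bounds the left side by the degree sum.\<close>

lemma lam_sum_le: "lam * (\<Sum>v\<in>V. x v) \<le> 12 * real n"
proof -
  have "lam * (\<Sum>v\<in>V. x v) \<le> (\<Sum>v\<in>V. \<Sum>w\<in>N v. x w)"
    unfolding sum_distrib_left by (rule sum_mono) (use subinvariant in auto)
  also have "\<dots> \<le> (\<Sum>v\<in>V. real (deg v))"
  proof (rule sum_mono)
    show "(\<Sum>w\<in>N v. x w) \<le> real (deg v)" for v
      using sum_x_le[of "N v" 1] x_le_1 by (auto simp: in_N)
  qed
  also have "\<dots> \<le> 12 * real n" using sum_deg_le[of V] by simp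
  finally show ?thesis .
qed

text \<open>Markov's inequality applied to \<open>lam_sum_le\<close>.\<close>

lemma card_level_le:
  assumes "t > 0"
  shows "real (card {v \<in> V. t \<le> x v}) * t * lam \<le> 12 * real n"
proof -
  have "real (card {v \<in> V. t \<le> x v}) * t = (\<Sum>v\<in>{v \<in> V. t \<le> x v}. t)" by simp
  also have "\<dots> \<le> (\<Sum>v\<in>{v \<in> V. t \<le> x v}. x v)" by (rule sum_mono) auto
  also have "\<dots> \<le> (\<Sum>v\<in>V. x v)" by (rule sum_mono2) (use x_nonneg in auto)
  finally have "real (card {v \<in> V. t \<le> x v}) * t * lam \<le> (\<Sum>v\<in>V. x v) * lam"
    using lam_nonneg by (rule mult_right_mono)
  then show ?thesis using lam_sum_le by (simp add: mult.commute)
qed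

lemma two_step:
  assumes "v < n"
  shows "lam\<^sup>2 * x v \<le> (\<Sum>y\<in>N v. lam * x y)"
proof -
  have "lam\<^sup>2 * x v = lam * (lam * x v)" by (simp add: power2_eq_square)
  also have "\<dots> \<le> lam * (\<Sum>y\<in>N v. x y)" using subinvariant[OF assms] lam_nonneg by (rule mult_left_mono)
  finally show ?thesis by (simp add: sum_distrib_left)
qed

text \<open>Walks of length two from \<open>v\<close> are sorted by their end. Returns to
  \<open>v\<close> contribute at most \<open>deg v\<close>, ends in \<open>T - {v}\<close> at most
  \<open>M\<close> each, and all other ends at most \<open>t\<close> each, of which sparsity allows
  \<open>12 * n\<close>.\<close>

lemma two_walk_le:
  assumes "v < n" "T \<subseteq> V" "0 \<le> t" "\<And>w. w \<in> V - T \<Longrightarrow> x w \<le> t"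
    and M: "0 \<le> M" "\<And>w. w \<in> T - {v} \<Longrightarrow> x w \<le> M"
  shows "lam\<^sup>2 * x v \<le> real (deg v) + M * real (\<Sum>y\<in>N v. card (nbrs E (T - {v}) y)) + 12 * real n * t"
proof -
  have one: "lam * x y \<le> 1 + M * real (card (nbrs E (T - {v}) y)) + t * real (deg y)" if y: "y \<in> N v" for y
  proof -
    let ?A = "N y \<inter> {v}" and ?B = "nbrs E (T - {v}) y" and ?C = "N y - insert v T"
    have fB: "finite ?B" using assms(2) finite_subset by (intro finite_nbrs) auto
    have "lam * x y \<le> (\<Sum>w\<in>N y. x w)" using subinvariant y in_N by auto
    also have "N y = ?A \<union> (?B \<union> ?C)" using assms(2) by (auto simp: nbrs_def)
    also have "(\<Sum>w\<in>\<dots>. x w) = (\<Sum>w\<in>?A. x w) + (\<Sum>w\<in>?B \<union> ?C. x w)"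
      using fB by (intro sum.union_disjoint) (auto simp: nbrs_def)
    also have "(\<Sum>w\<in>?B \<union> ?C. x w) = (\<Sum>w\<in>?B. x w) + (\<Sum>w\<in>?C. x w)"
      using fB by (intro sum.union_disjoint) (auto simp: nbrs_def)
    also have "(\<Sum>w\<in>?A. x w) \<le> 1 * real (card ?A)"
      by (rule sum_x_le) (use x_le_1 assms in auto)
    also have "\<dots> \<le> 1" using card_mono[of "{v}" ?A] by simp
    also have "(\<Sum>w\<in>?B. x w) \<le> M * real (card ?B)"
      by (rule sum_x_le) (use M assms(2) in \<open>auto simp: nbrs_def\<close>)
    also have "(\<Sum>w\<in>?C. x w) \<le> t * real (card ?C)"
      by (rule sum_x_le) (use assms(4) in \<open>auto simp: nbrs_def\<close>)
    also have "t * real (card ?C) \<le> t * real (deg y)"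
      using assms(3) by (intro mult_left_mono of_nat_mono card_mono) auto
    finally show ?thesis by simp
  qed
  have "lam\<^sup>2 * x v \<le> (\<Sum>y\<in>N v. lam * x y)" by (rule two_step[OF assms(1)])
  also have "\<dots> \<le> (\<Sum>y\<in>N v. 1 + M * real (card (nbrs E (T - {v}) y)) + t * real (deg y))"
    by (rule sum_mono) (rule one)
  also have "\<dots> = real (deg v) + M * real (\<Sum>y\<in>N v. card (nbrs E (T - {v}) y)) + t * real (\<Sum>y\<in>N v. deg y)"
    by (simp add: sum.distrib sum_distrib_left)
  also have "t * real (\<Sum>y\<in>N v. deg y) \<le> t * (12 * real n)"
    by (rule mult_left_mono) (use sum_deg_le[of "N v"] nbrs_subset assms(3) in auto)
  finally show ?thesis by (simp add: mult_ac)
qed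

text \<open>With this threshold, walks ending outside \<open>L\<close> contribute at most
  \<open>12 * n / 400 = 0.03 * n\<close> in \<open>two_walk_le\<close>.\<close>

definition L where "L = {w \<in> V. 1 / 400 \<le> x w}"

lemma L_subset: "L \<subseteq> V" and finite_L: "finite L"
  by (auto simp: L_def)

lemma L_degree:
  assumes "v \<in> L"
  shows "real n / 10000 \<le> real (deg v)"
proof -
  \<comment> \<open>Below the level \<open>1 / 4800\<close> the walk ends contribute at most
    \<open>n / 400\<close>, about half of the \<open>2 * (n - 2) / 400\<close> to be reached. As
    \<open>T\<close> has fewer than \<open>n / 10000\<close> elements, the rest must come from
    \<open>deg v\<close>.\<close>
  define T where "T = {w \<in> V. 1 / 4800 \<le> x w}"
  have v: "v < n" "1 / 400 \<le> x v" using assms by (auto simp: L_def)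
  have "real (card T) * (1 / 4800) * lam \<le> 12 * real n"
    unfolding T_def by (rule card_level_le) simp
  moreover have "real (card T) * (1 / 4800) * (6.5 * 10 ^ 8) \<le> real (card T) * (1 / 4800) * lam"
    by (rule mult_left_mono[OF lam_ge]) simp
  ultimately have T: "real (card T) * (1 / 4800) * (6.5 * 10 ^ 8) \<le> 12 * real n" by linarith
  have "(\<Sum>y\<in>N v. card (nbrs E (T - {v}) y)) \<le> 12 * (deg v + card (T - {v}))"
    by (rule cross_le) (auto simp: nbrs_def T_def)
  moreover have "card (T - {v}) \<le> card T" by (rule card_mono) (auto simp: T_def)
  ultimately have "(\<Sum>y\<in>N v. card (nbrs E (T - {v}) y)) \<le> 12 * (deg v + card T)"
    by (meson add_left_mono mult_le_mono2 order_trans)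
  then have c: "real (\<Sum>y\<in>N v. card (nbrs E (T - {v}) y)) \<le> 12 * (real (deg v) + real (card T))"
    using of_nat_mono[where 'a = real] by fastforce
  have "lam\<^sup>2 * x v \<le> real (deg v) + 1 * real (\<Sum>y\<in>N v. card (nbrs E (T - {v}) y)) + 12 * real n * (1 / 4800)"
    by (rule two_walk_le) (use v x_le_1 in \<open>auto simp: T_def\<close>)
  moreover have "(2 * (real n - 2)) * (1 / 400) \<le> lam\<^sup>2 * x v"
    using lam_large v n_large by (intro mult_mono) auto
  ultimately have "(2 * (real n - 2)) * (1 / 400) \<le> 13 * real (deg v) + 12 * real (card T) + real n / 400"
    using c by (simp add: field_simps)
  then show ?thesis using T n_large by simp
qed

lemma card_L: "card L \<le> 120000"
proof -
  have "real (card L) * (real n / 10000) = (\<Sum>v\<in>L. real n / 10000)" by simp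
  also have "\<dots> \<le> (\<Sum>v\<in>L. real (deg v))" by (rule sum_mono) (rule L_degree)
  also have "\<dots> \<le> 12 * real n" using sum_deg_le[OF L_subset] by simp
  finally have "real (card L) * real n \<le> 120000 * real n" by simp
  then show ?thesis using n_large by simp
qed

text \<open>A vertex of \<open>N v\<close> with two further neighbours in \<open>L\<close> is a common neighbour of three vertices,
  and each triple has at most two of those.\<close>

lemma cross_L_le:
  assumes "v < n"
  shows "(\<Sum>y\<in>N v. card (nbrs E (L - {v}) y)) \<le> deg v + 28800000000"
proof -
  define P where "P = {q \<in> (L - {v}) \<times> (L - {v}). fst q \<noteq> snd q}"
  define Q where "Q y = {q \<in> P. {y, fst q} \<in> E \<and> {y, snd q} \<in> E}" for y
  have fP: "finite P" using finite_L by (auto simp: P_def intro: finite_subset[of _ "L \<times> L"])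
  have one: "card (nbrs E (L - {v}) y) \<le> 1 + card (Q y)" for y
  proof -
    let ?M = "nbrs E (L - {v}) y"
    have fM: "finite ?M" using finite_L by simp
    have Q: "Q y = ?M \<times> ?M - (\<lambda>w. (w, w)) ` ?M"
      by (auto simp: Q_def P_def nbrs_def)
    have "card (Q y) = card (?M \<times> ?M) - card ((\<lambda>w. (w, w)) ` ?M)"
      unfolding Q using fM by (intro card_Diff_subset) auto
    also have "card ((\<lambda>w. (w, w)) ` ?M) = card ?M" by (rule card_image) (auto simp: inj_on_def)
    finally have "card (Q y) = card ?M * card ?M - card ?M" by (simp add: card_cartesian_product)
    \<comment> \<open>\<open>Q y\<close> holds the \<open>k * (k - 1)\<close> ordered pairs of
      distinct neighbours, which is at least \<open>k - 1\<close>.\<close>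
    moreover have "k \<le> 1 + (k * k - k)" for k :: nat by (cases k) auto
    ultimately show ?thesis by simp
  qed
  have two: "card {y \<in> N v. {y, fst q} \<in> E \<and> {y, snd q} \<in> E} \<le> 2" if "q \<in> P" for q
  proof -
    have "card {w \<in> V. {v, w} \<in> E \<and> {fst q, w} \<in> E \<and> {snd q, w} \<in> E} \<le> 2"
      using that assms L_subset by (intro K33_free) (auto simp: P_def)
    moreover have "{y \<in> N v. {y, fst q} \<in> E \<and> {y, snd q} \<in> E} = {w \<in> V. {v, w} \<in> E \<and> {fst q, w} \<in> E \<and> {snd q, w} \<in> E}"
      by (auto simp: nbrs_def insert_commute)
    ultimately show ?thesis by simp
  qed
  have "card P \<le> card (L \<times> L)" by (rule card_mono) (auto simp: P_def finite_L)
  also have "\<dots> = card L * card L" by (simp add: card_cartesian_product)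
  also have "\<dots> \<le> 120000 * 120000" using card_L by (intro mult_mono) auto
  \<comment> \<open>Twice this bound is the constant \<open>28800000000\<close> of the
    statement.\<close>
  finally have cP: "card P \<le> 14400000000" by simp
  have "(\<Sum>y\<in>N v. card (nbrs E (L - {v}) y)) \<le> (\<Sum>y\<in>N v. 1 + card (Q y))"
    by (rule sum_mono) (rule one)
  also have "\<dots> = deg v + (\<Sum>y\<in>N v. card (Q y))" by (simp only: sum.distrib) simp
  also have "(\<Sum>y\<in>N v. card (Q y)) = (\<Sum>q\<in>P. card {y \<in> N v. {y, fst q} \<in> E \<and> {y, snd q} \<in> E})"
    unfolding Q_def by (rule sum_card_filter_swap) (auto simp: fP)
  also have "\<dots> \<le> (\<Sum>q\<in>P. 2)" by (rule sum_mono) (rule two)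
  also have "\<dots> = 2 * card P" by simp
  finally show ?thesis using cP by simp
qed

lemma walk_L_le:
  assumes "v < n" "0 \<le> M" "\<And>w. w \<in> L - {v} \<Longrightarrow> x w \<le> M"
  shows "lam\<^sup>2 * x v \<le> real (deg v) + M * (real (deg v) + 28800000000) + 0.03 * real n"
proof -
  have "lam\<^sup>2 * x v \<le> real (deg v) + M * real (\<Sum>y\<in>N v. card (nbrs E (L - {v}) y)) + 12 * real n * (1 / 400)"
    by (rule two_walk_le) (use assms L_subset in \<open>auto simp: L_def\<close>)
  moreover have "real (\<Sum>y\<in>N v. card (nbrs E (L - {v}) y)) \<le> real (deg v + 28800000000)"
    using cross_L_le[OF assms(1)] by (rule of_nat_mono)
  then have "M * real (\<Sum>y\<in>N v. card (nbrs E (L - {v}) y)) \<le> M * real (deg v + 28800000000)"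
    using assms(2) by (rule mult_left_mono)
  ultimately show ?thesis by simp
qed

text \<open>Take \<open>M = 1\<close> in \<open>walk_L_le\<close> and halve: the loss is
  \<open>0.015 * n\<close> plus a constant near \<open>1.44 * 10 ^ 10\<close>, which
  \<open>0.0001 * n\<close> absorbs.\<close>

lemma degree_ge:
  assumes "v < n"
  shows "(x v - 0.0151) * real n \<le> real (deg v)"
proof -
  have "lam\<^sup>2 * x v \<le> real (deg v) + 1 * (real (deg v) + 28800000000) + 0.03 * real n"
    by (rule walk_L_le) (use assms x_le_1 L_subset in auto)
  moreover have "(2 * (real n - 2)) * x v \<le> lam\<^sup>2 * x v"
    using lam_large x_nonneg[OF assms] by (rule mult_right_mono)
  ultimately have "2 * (real n * x v) - 4 * x v \<le> 2 * real (deg v) + 28800000000 + 0.03 * real n"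
    by (simp add: algebra_simps)
  then show ?thesis using x_le_1[OF assms] n_large by (simp add: algebra_simps)
qed

text \<open>If no other entry reached \<open>0.9698\<close>, the walk count at \<open>u\<close>
  would give at most \<open>1.9698 * n + 0.03 * n\<close> plus a constant, short of
  \<open>2 * (n - 2)\<close> for such large \<open>n\<close>.\<close>

lemma second_hub: "\<exists>v<n. v \<noteq> u \<and> 0.9698 \<le> x v"
proof (rule ccontr)
  assume "\<not> ?thesis"
  then have "x w \<le> 0.9698" if "w \<in> L - {u}" for w using that L_subset by force
  then have "lam\<^sup>2 * x u \<le> real (deg u) + 0.9698 * (real (deg u) + 28800000000) + 0.03 * real n"
    using u by (intro walk_L_le) auto
  then have "2 * (real n - 2) \<le> real (deg u) + 0.9698 * (real (deg u) + 28800000000) + 0.03 * real n"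
    using lam_large u by simp
  moreover have "real (deg u) \<le> real n" using deg_le by simp
  ultimately have "2 * real n - 4 \<le> 1.9998 * real n + 28800000000" by (simp add: field_simps)
  then show False using n_large by simp
qed

section \<open>The structure around the two hubs\<close>

theorem is_complete_bipartite:
  "\<exists>v<n. u \<noteq> v \<and> (\<forall>a<n. \<forall>b<n. {a, b} \<in> E \<longleftrightarrow> (a \<in> {u, v}) \<noteq> (b \<in> {u, v}))"
proof -
  obtain v where v: "v < n" "v \<noteq> u" "0.9698 \<le> x v" using second_hub by blast
  have "(0.9698 - 0.0151) * real n \<le> (x v - 0.0151) * real n"
    using v(3) by (intro mult_right_mono) auto
  then have dv: "0.9547 * real n \<le> real (deg v)" using degree_ge[OF v(1)] by simp
  have du: "0.9849 * real n \<le> real (deg u)" using degree_ge[OF u(1)] u(2) by simp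
  define A where "A = N u \<inter> N v"
  define R where "R = V - {u, v} - A"
  have uvA: "u \<notin> A" "v \<notin> A" using loop_free by (auto simp: A_def nbrs_def)
  have AV: "A \<subseteq> V" "R \<subseteq> V" "finite A" "finite R" "A \<inter> R = {}"
    by (auto simp: A_def R_def nbrs_def)
  have Vsplit: "V = {u, v} \<union> (A \<union> R)" using u v AV uvA by (auto simp: R_def)
  have "card V = card {u, v} + card (A \<union> R)"
    by (subst Vsplit, rule card_Un_disjoint) (use AV uvA in \<open>auto simp: R_def\<close>)
  then have nAR: "real n = 2 + real (card A) + real (card R)"
    using v AV by (simp add: card_Un_disjoint)
  have "R \<subseteq> (V - N u) \<union> (V - N v)" by (auto simp: R_def A_def)
  then have "card R \<le> card ((V - N u) \<union> (V - N v))" by (rule card_mono[rotated]) auto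
  also have "\<dots> \<le> card (V - N u) + card (V - N v)" by (rule card_Un_le)
  also have "\<dots> = (n - deg u) + (n - deg v)"
    using nbrs_subset[of V] by (simp add: card_Diff_subset finite_subset)
  finally have "real (card R) \<le> (real n - real (deg u)) + (real n - real (deg v))"
    using deg_le[of u] deg_le[of v] by linarith
  \<comment> \<open>A vertex of \<open>R\<close> misses \<open>u\<close> or \<open>v\<close>, and
    \<open>0.0604 = (1 - 0.9849) + (1 - 0.9547)\<close>.\<close>
  then have Rn: "real (card R) \<le> 0.0604 * real n" using du dv by simp
  have "2 \<le> card A" using nAR Rn n_large by simp
  then obtain a b where ab: "a \<in> A" "b \<in> A" "a \<noteq> b"
    by (metis card_le_Suc0_iff_eq AV(3) not_less_eq_eq numeral_2_eq_2)
  \<comment> \<open>An edge between the hubs would be shared by the triangles through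
    \<open>a\<close> and \<open>b\<close>.\<close>
  have uv: "{u, v} \<notin> E"
  proof
    assume "{u, v} \<in> E"
    then have "distinct [u, v, a, b] \<and> {u, v} \<in> E \<and> {u, a} \<in> E \<and> {v, a} \<in> E \<and> {u, b} \<in> E \<and> {v, b} \<in> E"
      using ab uvA v by (auto simp: A_def nbrs_def)
    then show False using C3C3_free unfolding contains_C3C3_def by blast
  qed
  have A_edge: "{u, c} \<in> E" "{v, c} \<in> E" "{c, u} \<in> E" "{c, v} \<in> E" if "c \<in> A" for c
    using that by (auto simp: A_def nbrs_def insert_commute)
  \<comment> \<open>An edge inside \<open>A\<close> would be shared by the triangles through
    \<open>u\<close> and \<open>v\<close>.\<close>
  have indep: "{c, d} \<notin> E" if "c \<in> A" "d \<in> A" for c d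
  proof
    assume "{c, d} \<in> E"
    moreover then have "c \<noteq> d" using loop_free by auto
    ultimately have "distinct [c, d, u, v] \<and> {c, d} \<in> E \<and> {c, u} \<in> E \<and> {d, u} \<in> E \<and> {c, v} \<in> E \<and> {d, v} \<in> E"
      using that uvA v A_edge by auto
    then show False using C3C3_free unfolding contains_C3C3_def by blast
  qed
  \<comment> \<open>Neighbours of \<open>w\<close> in \<open>A\<close> are common neighbours of the
    three vertices \<open>u\<close>, \<open>v\<close>, \<open>w\<close>.\<close>
  have A2: "card (nbrs E A w) \<le> 2" if "w \<in> A \<union> R" for w
  proof -
    have "w < n" "w \<noteq> u" "w \<noteq> v" using that AV uvA by (auto simp: R_def)
    then have "card {y \<in> V. {u, y} \<in> E \<and> {v, y} \<in> E \<and> {w, y} \<in> E} \<le> 2"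
      using u v by (intro K33_free) auto
    moreover have "nbrs E A w = {y \<in> V. {u, y} \<in> E \<and> {v, y} \<in> E \<and> {w, y} \<in> E}"
      by (auto simp: nbrs_def A_def)
    ultimately show ?thesis by simp
  qed
  define m where "m = Max (x ` (A \<union> R))"
  have neA: "A \<union> R \<noteq> {}" using ab by auto
  have m_ge: "x w \<le> m" if "w \<in> A \<union> R" for w
    unfolding m_def using that AV by (intro Max_ge) auto
  have "m \<in> x ` (A \<union> R)" unfolding m_def using neA AV by (intro Max_in) auto
  then obtain w where w: "w \<in> A \<union> R" "x w = m" by auto
  have wn: "w < n" using w AV by auto
  have m01: "0 \<le> m" "m \<le> 1" using x_nonneg[OF wn] x_le_1[OF wn] w by auto
  have step: "lam * x y \<le> (\<Sum>z\<in>N y \<inter> {u, v}. x z) + (\<Sum>z\<in>nbrs E A y. x z) + (\<Sum>z\<in>nbrs E R y. x z)" if "y < n" for y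
  proof -
    have "N y = (N y \<inter> {u, v}) \<union> (nbrs E A y \<union> nbrs E R y)"
      unfolding nbrs_def using Vsplit AV by blast
    then have "(\<Sum>z\<in>N y. x z) = (\<Sum>z\<in>(N y \<inter> {u, v}) \<union> (nbrs E A y \<union> nbrs E R y). x z)" by simp
    also have "\<dots> = (\<Sum>z\<in>N y \<inter> {u, v}. x z) + (\<Sum>z\<in>nbrs E A y \<union> nbrs E R y. x z)"
      using AV uvA by (intro sum.union_disjoint) (auto simp: nbrs_def R_def)
    also have "(\<Sum>z\<in>nbrs E A y \<union> nbrs E R y. x z) = (\<Sum>z\<in>nbrs E A y. x z) + (\<Sum>z\<in>nbrs E R y. x z)"
      using AV by (intro sum.union_disjoint) (auto simp: nbrs_def)
    finally show ?thesis using subinvariant[OF that] by simp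
  qed
  have hub_le: "(\<Sum>z\<in>N y \<inter> {u, v}. x z) \<le> real (card (N y \<inter> {u, v}))" for y
    using sum_x_le[of "N y \<inter> {u, v}" 1] x_le_1 by (auto simp: in_N)
  have Ay: "lam * x y \<le> 2 + (\<Sum>z\<in>nbrs E R y. x z)" if "y \<in> A" for y
  proof -
    have "nbrs E A y = {}" using indep that by (auto simp: nbrs_def)
    moreover have "card (N y \<inter> {u, v}) \<le> card {u, v}" by (rule card_mono) auto
    then have "card (N y \<inter> {u, v}) \<le> 2" using v by simp
    ultimately show ?thesis using step[of y] hub_le[of y] that AV by auto
  qed
  have Ry: "lam * x y \<le> 1 + 2 * m + (\<Sum>z\<in>nbrs E R y. x z)" if "y \<in> R" for y
  proof -
    have "{y, u} \<notin> E \<or> {y, v} \<notin> E"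
      using that by (auto simp: R_def A_def nbrs_def insert_commute)
    then have "N y \<inter> {u, v} \<subseteq> {u} \<or> N y \<inter> {u, v} \<subseteq> {v}" by (auto simp: nbrs_def)
    then have "card (N y \<inter> {u, v}) \<le> 1" using card_mono[of "{u}"] card_mono[of "{v}"] by fastforce
    moreover have "(\<Sum>z\<in>nbrs E A y. x z) \<le> m * real (card (nbrs E A y))"
      by (rule sum_x_le) (use m_ge AV in \<open>auto simp: nbrs_def\<close>)
    moreover have "m * real (card (nbrs E A y)) \<le> m * 2"
      using A2[of y] that m01 by (intro mult_left_mono) auto
    ultimately show ?thesis using step[of y] hub_le[of y] that AV by auto
  qed
  \<comment> \<open>Each vertex of \<open>R\<close> sees at most one hub and at most two vertices of
    \<open>A\<close>, giving \<open>1 + 2 * m\<close>; sparsity of \<open>R\<close> adds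
    \<open>12 * m\<close> on average.\<close>
  have Rsum: "(\<Sum>y\<in>R. lam * x y) \<le> real (card R) * (1 + 14 * m)"
  proof -
    have "(\<Sum>y\<in>R. lam * x y) \<le> (\<Sum>y\<in>R. 1 + 2 * m + m * real (card (nbrs E R y)))"
    proof (rule sum_mono)
      fix y assume "y \<in> R"
      moreover have "(\<Sum>z\<in>nbrs E R y. x z) \<le> m * real (card (nbrs E R y))"
        by (rule sum_x_le) (use m_ge AV in \<open>auto simp: nbrs_def\<close>)
      ultimately show "lam * x y \<le> 1 + 2 * m + m * real (card (nbrs E R y))" using Ry by fastforce
    qed
    also have "\<dots> = real (card R) * (1 + 2 * m) + m * real (degree_sum E R)"
      by (simp add: sum.distrib sum_distrib_left degree_sum_def)
    also have "m * real (degree_sum E R) \<le> m * (12 * real (card R))"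
      using sparse[OF AV(2)] m01 by (intro mult_left_mono) auto
    finally show ?thesis by (simp add: algebra_simps)
  qed
  \<comment> \<open>Two steps from the vertex \<open>w\<close> of entry \<open>m\<close> give
    \<open>lam * lam * m \<le> 4 * lam + card R * (1 + 14 * m)\<close>, where \<open>4\<close>
    covers both \<open>2\<close> on \<open>A\<close> and \<open>1 + 2 * m\<close> on
    \<open>R\<close>. The term \<open>4 * lam\<close> is negligible against
    \<open>lam * lam\<close>. With \<open>lam * lam\<close> at least \<open>1.9999 * n\<close> and
    \<open>card R\<close> at most \<open>0.0604 * n\<close>, \<open>m\<close> is at most about
    \<open>0.053\<close>.\<close>
  have m_small: "m < 1 / 16"
  proof -
    have "lam * x y \<le> 4 + (\<Sum>z\<in>nbrs E R y. x z)" if "y \<in> A \<union> R" for y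
      using Ay[of y] Ry[of y] that m01 by auto
    then have "lam * x w \<le> 4 + (\<Sum>z\<in>nbrs E R w. x z)" using w by blast
    then have "lam * (lam * x w) \<le> lam * (4 + (\<Sum>z\<in>nbrs E R w. x z))"
      using lam_nonneg by (rule mult_left_mono)
    also have "\<dots> = 4 * lam + (\<Sum>z\<in>nbrs E R w. lam * x z)" by (simp add: algebra_simps sum_distrib_left)
    also have "(\<Sum>z\<in>nbrs E R w. lam * x z) \<le> (\<Sum>z\<in>R. lam * x z)"
      by (rule sum_mono2) (use AV x_nonneg lam_nonneg in \<open>auto simp: nbrs_def\<close>)
    also note Rsum
    finally have "lam * lam * m \<le> 4 * lam + real (card R) * (1 + 14 * m)" using w by (simp add: mult.assoc)
    moreover have "4 * lam \<le> lam * lam * 0.0001"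
      using mult_left_mono[of 40000 lam lam] lam_ge by simp
    moreover have "real (card R) * (1 + 14 * m) \<le> (0.0604 * real n) * (1 + 14 * m)"
      using Rn m01 by (intro mult_right_mono) auto
    ultimately have le: "lam * lam * (m - 0.0001) \<le> (0.0604 * real n) * (1 + 14 * m)"
      by (simp add: algebra_simps)
    show ?thesis
    proof (rule ccontr)
      assume big: "\<not> m < 1 / 16"
      have "1.9999 * real n \<le> lam * lam" using lam_large n_large by (simp add: power2_eq_square)
      then have "1.9999 * real n * (m - 0.0001) \<le> lam * lam * (m - 0.0001)"
        using big by (intro mult_right_mono) auto
      also note le
      finally have "real n * (1.9999 * (m - 0.0001)) \<le> real n * (0.0604 * (1 + 14 * m))"
        by (simp only: mult_ac)
      then have "1.9999 * (m - 0.0001) \<le> 0.0604 * (1 + 14 * m)"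
        using n_large by (simp add: mult_le_cancel_left)
      then show False using big by simp
    qed
  qed
  have Asum: "(\<Sum>y\<in>A. lam * x y) \<le> 2 * real (card A) + 2 * m * real (card R)"
  proof -
    have "(\<Sum>y\<in>A. lam * x y) \<le> (\<Sum>y\<in>A. 2 + m * real (card (nbrs E R y)))"
    proof (rule sum_mono)
      fix y assume "y \<in> A"
      moreover have "(\<Sum>z\<in>nbrs E R y. x z) \<le> m * real (card (nbrs E R y))"
        by (rule sum_x_le) (use m_ge AV in \<open>auto simp: nbrs_def\<close>)
      ultimately show "lam * x y \<le> 2 + m * real (card (nbrs E R y))" using Ay by fastforce
    qed
    also have "\<dots> = 2 * real (card A) + m * real (\<Sum>y\<in>A. card (nbrs E R y))"
      by (simp add: sum.distrib sum_distrib_left)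
    \<comment> \<open>Edges between \<open>A\<close> and \<open>R\<close> are counted from the side
      of \<open>R\<close>, where \<open>A2\<close> allows at most two per vertex.\<close>
    also have "(\<Sum>y\<in>A. card (nbrs E R y)) = (\<Sum>z\<in>R. card (nbrs E A z))"
      using AV by (intro sum_nbrs_swap) auto
    also have "m * real (\<Sum>z\<in>R. card (nbrs E A z)) \<le> m * real (\<Sum>z\<in>R. 2)"
      using A2 m01 by (intro mult_left_mono of_nat_mono sum_mono) auto
    finally show ?thesis by simp
  qed
  have "2 * (real n - 2) \<le> lam\<^sup>2 * x u" using lam_large u by simp
  also have "\<dots> \<le> (\<Sum>y\<in>N u. lam * x y)" by (rule two_step[OF u(1)])
  \<comment> \<open>As the hubs are not adjacent, \<open>N u\<close> avoids
    \<open>v\<close>.\<close>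
  also have "\<dots> \<le> (\<Sum>y\<in>A \<union> R. lam * x y)"
  proof (rule sum_mono2)
    show "N u \<subseteq> A \<union> R" using Vsplit uv loop_free nbrs_subset[of V u] by (auto simp: nbrs_def)
  qed (use AV x_nonneg lam_nonneg in auto)
  also have "\<dots> = (\<Sum>y\<in>A. lam * x y) + (\<Sum>y\<in>R. lam * x y)"
    using AV by (intro sum.union_disjoint) auto
  finally have "2 * (real n - 2) \<le> 2 * real (card A) + real (card R) * (1 + 16 * m)"
    using Asum Rsum by (simp add: algebra_simps)
  \<comment> \<open>Each vertex of \<open>R\<close> contributes at most
    \<open>1 + 16 * m < 2\<close> where \<open>2\<close> would be needed, so \<open>R\<close> must
    be empty.\<close>
  then have "real (card R) * (1 - 16 * m) \<le> 0" using nAR by (simp add: algebra_simps)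
  then have "card R = 0" using m_small by (simp add: mult_le_0_iff)
  then have "R = {}" using AV by simp
  then have VA: "V = {u, v} \<union> A" using Vsplit by simp
  have "{c, d} \<in> E \<longleftrightarrow> (c \<in> {u, v}) \<noteq> (d \<in> {u, v})" if "c < n" "d < n" for c d
  proof -
    have mem: "c \<in> {u, v} \<union> A" "d \<in> {u, v} \<union> A" using that VA[symmetric] by simp_all
    have non: "{v, u} \<notin> E" "{u, u} \<notin> E" "{v, v} \<notin> E"
      using uv loop_free[of u] loop_free[of v] by (simp_all add: insert_commute[of v u])
    show ?thesis
    proof (cases "c \<in> A")
      case True
      then show ?thesis using mem(2) indep[of c d] A_edge[of c] uvA by auto
    next
      case False
      then have "c \<in> {u, v}" using mem(1) by simp
      then show ?thesis using mem(2) A_edge[of d] uvA uv non by auto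
    qed
  qed
  then show ?thesis using v by blast
qed

end

section \<open>Spectral radii of graphs\<close>

lemma adj_matrix_carrier: "adj_matrix n E \<in> carrier_mat n n"
  by (simp add: adj_matrix_def)

lemma adj_matrix_mult_vec:
  assumes "z \<in> carrier_vec n" "i < n"
  shows "(adj_matrix n E *\<^sub>v z) $ i = (\<Sum>j\<in>nbrs E {0..<n} i. z $ j)"
proof -
  have "(adj_matrix n E *\<^sub>v z) $ i = (\<Sum>j\<in>{0..<n}. (if {i, j} \<in> E then 1 else 0) * z $ j)"
    using assms by (simp add: adj_matrix_def scalar_prod_def)
  also have "\<dots> = (\<Sum>j\<in>{0..<n}. if {i, j} \<in> E then z $ j else 0)"
    by (rule sum.cong) auto
  also have "\<dots> = (\<Sum>j\<in>nbrs E {0..<n} i. z $ j)"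
    unfolding nbrs_def by (rule sum.inter_filter[symmetric]) simp
  finally show ?thesis .
qed

lemma adj_eigenvector_iff:
  "eigenvector (adj_matrix n E) z k \<longleftrightarrow> z \<in> carrier_vec n \<and> z \<noteq> 0\<^sub>v n \<and>
    (\<forall>i<n. (\<Sum>j\<in>nbrs E {0..<n} i. z $ j) = k * z $ i)"
proof -
  have "adj_matrix n E *\<^sub>v z = k \<cdot>\<^sub>v z \<longleftrightarrow> (\<forall>i<n. (\<Sum>j\<in>nbrs E {0..<n} i. z $ j) = k * z $ i)"
    if z: "z \<in> carrier_vec n"
  proof -
    have d: "dim_vec (adj_matrix n E *\<^sub>v z) = n" "dim_vec (k \<cdot>\<^sub>v z) = n"
      using z by (auto simp: adj_matrix_def)
    have "adj_matrix n E *\<^sub>v z = k \<cdot>\<^sub>v z \<longleftrightarrow> (\<forall>i<n. (adj_matrix n E *\<^sub>v z) $ i = (k \<cdot>\<^sub>v z) $ i)"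
      using d by (metis eq_vecI)
    then show ?thesis using z by (simp add: adj_matrix_mult_vec del: index_mult_mat_vec)
  qed
  moreover have "dim_row (adj_matrix n E) = n" by (simp add: adj_matrix_def)
  ultimately show ?thesis unfolding eigenvector_def by auto
qed

lemma spectral_radius_eigenvector:
  assumes "n > 0"
  obtains k z where "graph_spectral_radius n E = norm k" "eigenvector (adj_matrix n E) z k"
proof -
  have "graph_spectral_radius n E \<in> norm ` spectrum (adj_matrix n E)"
    unfolding graph_spectral_radius_def by (rule spectral_radius_mem_max(1)[OF adj_matrix_carrier assms])
  then obtain k where "graph_spectral_radius n E = norm k" "k \<in> spectrum (adj_matrix n E)" by auto
  then show thesis using that by (auto simp: spectrum_def eigenvalue_def)
qed

lemma eigenvector_spectral_radius_ge:
  assumes "n > 0" "eigenvector (adj_matrix n E) z k"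
  shows "norm k \<le> graph_spectral_radius n E"
  unfolding graph_spectral_radius_def
  by (rule spectral_radius_mem_max(2)[OF adj_matrix_carrier assms(1)])
    (use assms(2) in \<open>unfold spectrum_def eigenvalue_def, blast\<close>)

text \<open>The triangle inequality in the eigenvalue equation makes the moduli of an eigenvector
  subinvariant; dividing by their maximum gives the scaling.\<close>

lemma spectral_radius_subinvariant:
  assumes "n > 0"
  obtains x :: "nat \<Rightarrow> real" and u where "u < n" "x u = 1" "0 \<le> graph_spectral_radius n E"
    "\<forall>v<n. 0 \<le> x v \<and> x v \<le> 1 \<and> graph_spectral_radius n E * x v \<le> (\<Sum>w\<in>nbrs E {0..<n} v. x w)"
proof -
  let ?r = "graph_spectral_radius n E"
  obtain k z where k: "?r = norm k" and "eigenvector (adj_matrix n E) z k"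
    using spectral_radius_eigenvector[OF assms] by blast
  then have z: "z \<in> carrier_vec n" "z \<noteq> 0\<^sub>v n"
    and ev: "\<And>i. i < n \<Longrightarrow> (\<Sum>j\<in>nbrs E {0..<n} i. z $ j) = k * z $ i"
    by (auto simp: adj_eigenvector_iff)
  define M where "M = Max ((\<lambda>i. norm (z $ i)) ` {0..<n})"
  have ge: "norm (z $ i) \<le> M" if "i < n" for i
    unfolding M_def using that by (intro Max_ge) auto
  have "M \<in> (\<lambda>i. norm (z $ i)) ` {0..<n}" unfolding M_def using assms by (intro Max_in) auto
  then obtain u where u: "u < n" "norm (z $ u) = M" by auto
  obtain i where i: "i < n" "z $ i \<noteq> 0"
    using z by (metis carrier_vecD eq_vecI index_zero_vec(1) index_zero_vec(2))
  then have M: "M > 0" using ge[OF i(1)] by (metis less_le_trans zero_less_norm_iff)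
  have sub: "?r * (norm (z $ v) / M) \<le> (\<Sum>j\<in>nbrs E {0..<n} v. norm (z $ j) / M)" if v: "v < n" for v
  proof -
    have "?r * norm (z $ v) = norm (k * z $ v)" by (simp add: k norm_mult)
    also have "\<dots> = norm (\<Sum>j\<in>nbrs E {0..<n} v. z $ j)" by (simp add: ev[OF v])
    also have "\<dots> \<le> (\<Sum>j\<in>nbrs E {0..<n} v. norm (z $ j))" by (rule norm_sum)
    finally have "?r * norm (z $ v) / M \<le> (\<Sum>j\<in>nbrs E {0..<n} v. norm (z $ j)) / M"
      using M by (simp add: divide_right_mono)
    then show ?thesis by (simp add: sum_divide_distrib)
  qed
  show thesis
    by (rule that[of u "\<lambda>i. norm (z $ i) / M"]) (use u M ge k sub in auto)
qed

lemma K2n_iff: "{i, j} \<in> K2n n \<longleftrightarrow> (i < 2 \<and> 2 \<le> j \<and> j < n) \<or> (j < 2 \<and> 2 \<le> i \<and> i < n)"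
  unfolding K2n_def by (auto simp: doubleton_eq_iff)

lemma spectral_radius_K2n_ge:
  assumes "n \<ge> 3"
  shows "sqrt (2 * (real n - 2)) \<le> graph_spectral_radius n (K2n n)"
proof -
  let ?s = "sqrt (real n - 2)"
  let ?k = "complex_of_real (sqrt 2 * ?s)"
  \<comment> \<open>Constant entries \<open>s\<close> on the two hubs and \<open>t\<close> on the
    rest form an eigenvector for \<open>k\<close> when \<open>(n - 2) * t = k * s\<close> and
    \<open>2 * s = k * t\<close>; this choice solves both.\<close>
  define z where "z = Matrix.vec n (\<lambda>i. if i < 2 then complex_of_real ?s else complex_of_real (sqrt 2))"
  have ss: "?s * ?s = real n - 2" using assms by simp
  have "(\<Sum>j\<in>nbrs (K2n n) {0..<n} i. z $ j) = ?k * z $ i" if i: "i < n" for i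
  proof (cases "i < 2")
    case True
    have "nbrs (K2n n) {0..<n} i = {2..<n}" using True by (auto simp: nbrs_def K2n_iff)
    then have "(\<Sum>j\<in>nbrs (K2n n) {0..<n} i. z $ j) = (\<Sum>j\<in>{2..<n}. complex_of_real (sqrt 2))"
      by (auto simp: z_def intro!: sum.cong)
    also have "\<dots> = complex_of_real (sqrt 2 * (?s * ?s))"
      unfolding ss using assms by (simp add: of_nat_diff)
    also have "\<dots> = ?k * complex_of_real ?s" by (simp only: of_real_mult mult.assoc)
    finally show ?thesis using True i by (simp add: z_def)
  next
    case False
    have "nbrs (K2n n) {0..<n} i = {0, 1}" using False i by (auto simp: nbrs_def K2n_iff)
    then have "(\<Sum>j\<in>nbrs (K2n n) {0..<n} i. z $ j) = complex_of_real (2 * ?s)"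
      using assms by (simp add: z_def)
    also have "2 * ?s = sqrt 2 * ?s * sqrt 2" by simp
    finally show ?thesis using False i by (simp add: z_def)
  qed
  moreover have "z \<noteq> 0\<^sub>v n"
  proof
    assume "z = 0\<^sub>v n"
    then have "z $ 2 = 0" using assms by simp
    then show False using assms by (simp add: z_def)
  qed
  moreover have "z \<in> carrier_vec n" by (simp add: z_def)
  ultimately have "eigenvector (adj_matrix n (K2n n)) z ?k"
    by (simp add: adj_eigenvector_iff)
  then have "norm ?k \<le> graph_spectral_radius n (K2n n)"
    using assms by (intro eigenvector_spectral_radius_ge) auto
  moreover have "norm ?k = sqrt (2 * (real n - 2))"
    using assms by (simp add: norm_mult flip: real_sqrt_mult)
  ultimately show ?thesis by simp
qed

section \<open>Isomorphism and the spectral radius\<close>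

lemma graph_iso_sym:
  assumes "graph_iso n E F"
  shows "graph_iso n F E"
proof -
  obtain f where f: "bij_betw f {0..<n} {0..<n}"
    and fE: "\<And>u v. u \<in> {0..<n} \<Longrightarrow> v \<in> {0..<n} \<Longrightarrow> {u, v} \<in> E \<longleftrightarrow> {f u, f v} \<in> F"
    using assms unfolding graph_iso_def by blast
  let ?g = "inv_into {0..<n} f"
  have g: "bij_betw ?g {0..<n} {0..<n}" using f by (rule bij_betw_inv_into)
  have "{u, v} \<in> F \<longleftrightarrow> {?g u, ?g v} \<in> E" if "u \<in> {0..<n}" "v \<in> {0..<n}" for u v
    using fE[of "?g u" "?g v"] bij_betwE[OF g] bij_betw_inv_into_right[OF f] that by auto
  then show ?thesis unfolding graph_iso_def using g by blast
qed

text \<open>An eigenvector of \<open>E\<close> carried along the isomorphism is an eigenvector of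
  \<open>F\<close> for the same eigenvalue. Equality will follow by symmetry of
  \<open>graph_iso\<close>.\<close>

lemma graph_iso_spectral_radius_le:
  assumes "graph_iso n E F" "n > 0"
  shows "graph_spectral_radius n E \<le> graph_spectral_radius n F"
proof -
  obtain f where f: "bij_betw f {0..<n} {0..<n}"
    and fE: "\<And>u v. u \<in> {0..<n} \<Longrightarrow> v \<in> {0..<n} \<Longrightarrow> {u, v} \<in> E \<longleftrightarrow> {f u, f v} \<in> F"
    using assms unfolding graph_iso_def by blast
  let ?g = "inv_into {0..<n} f"
  have fimg: "f ` {0..<n} = {0..<n}" and finj: "inj_on f {0..<n}"
    using f by (auto simp: bij_betw_def)
  obtain k z where k: "graph_spectral_radius n E = norm k" and "eigenvector (adj_matrix n E) z k"
    using spectral_radius_eigenvector[OF assms(2)] by blast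
  then have z: "z \<in> carrier_vec n" "z \<noteq> 0\<^sub>v n"
    and ev: "\<And>i. i < n \<Longrightarrow> (\<Sum>j\<in>nbrs E {0..<n} i. z $ j) = k * z $ i"
    by (auto simp: adj_eigenvector_iff)
  define w where "w = Matrix.vec n (\<lambda>j. z $ (?g j))"
  have wf: "w $ f i = z $ i" and fn: "f i < n" if "i < n" for i
  proof -
    show "f i < n" using that fimg by auto
    then show "w $ f i = z $ i" using that finj by (simp add: w_def)
  qed
  have "(\<Sum>l\<in>nbrs F {0..<n} j. w $ l) = k * w $ j" if "j < n" for j
  proof -
    have "j \<in> f ` {0..<n}" unfolding fimg using that by simp
    then obtain i where i: "i < n" "j = f i" by auto
    have "nbrs F {0..<n} j = f ` nbrs E {0..<n} i"
    proof -
      have "nbrs F {0..<n} j = {l \<in> f ` {0..<n}. {f i, l} \<in> F}" by (simp add: nbrs_def i fimg)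
      also have "\<dots> = f ` {l \<in> {0..<n}. {f i, f l} \<in> F}" by auto
      also have "{l \<in> {0..<n}. {f i, f l} \<in> F} = nbrs E {0..<n} i"
        using fE[of i] i by (auto simp: nbrs_def)
      finally show ?thesis .
    qed
    moreover have "inj_on f (nbrs E {0..<n} i)"
      using finj by (rule inj_on_subset) (auto simp: nbrs_def)
    ultimately have "(\<Sum>l\<in>nbrs F {0..<n} j. w $ l) = (\<Sum>l\<in>nbrs E {0..<n} i. w $ f l)"
      by (simp add: sum.reindex)
    also have "\<dots> = (\<Sum>l\<in>nbrs E {0..<n} i. z $ l)" by (rule sum.cong) (auto simp: nbrs_def wf)
    finally show ?thesis using ev[OF i(1)] wf[OF i(1)] i(2) by simp
  qed
  moreover have "w \<noteq> 0\<^sub>v n"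
  proof
    assume "w = 0\<^sub>v n"
    then have "z $ i = 0" if "i < n" for i using wf[OF that] fn[OF that] by simp
    then have "z = 0\<^sub>v n" using z(1) by (intro eq_vecI) auto
    then show False using z(2) by simp
  qed
  moreover have "w \<in> carrier_vec n" by (simp add: w_def)
  ultimately have "eigenvector (adj_matrix n F) w k" by (simp add: adj_eigenvector_iff)
  then show ?thesis
    unfolding k by (rule eigenvector_spectral_radius_ge[OF assms(2)])
qed

text \<open>Send \<open>u\<close>, \<open>v\<close> to \<open>0\<close>, \<open>1\<close> and the
  other vertices to \<open>{2..<n}\<close> by any bijection: in both graphs adjacency means lying on
  different sides.\<close>

lemma graph_iso_K2nI:
  assumes "u < n" "v < n" "u \<noteq> v"
    and E: "\<And>a b. a < n \<Longrightarrow> b < n \<Longrightarrow> {a, b} \<in> E \<longleftrightarrow> (a \<in> {u, v}) \<noteq> (b \<in> {u, v})"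
  shows "graph_iso n E (K2n n)"
proof -
  have "card ({0..<n} - {u, v}) = card {2..<n}"
    using assms(1-3) by (simp add: card_Diff_subset)
  then obtain h where h: "bij_betw h ({0..<n} - {u, v}) {2..<n}"
    using finite_same_card_bij[of "{0..<n} - {u, v}" "{2..<n}"] by auto
  define f where "f w = (if w = u then 0 else if w = v then 1 else h w)" for w
  have "bij_betw f ({0..<n} - {u, v}) {2..<n}"
    using h by (subst bij_betw_cong[of _ f h]) (auto simp: f_def)
  moreover have "bij_betw f {u, v} {0, 1}"
    using assms(3) by (auto simp: bij_betw_def f_def inj_on_def)
  ultimately have "bij_betw f (({0..<n} - {u, v}) \<union> {u, v}) ({2..<n} \<union> {0, 1})"
    by (rule bij_betw_combine) auto
  moreover have "({0..<n} - {u, v}) \<union> {u, v} = {0..<n}" "{2..<n} \<union> {0, 1} = {0..<n}"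
    using assms(1-3) by auto
  ultimately have f: "bij_betw f {0..<n} {0..<n}" by simp
  have hub: "f a < 2 \<longleftrightarrow> a \<in> {u, v}" "f a < n" if "a < n" for a
  proof -
    show "f a < n" using bij_betwE[OF f] that by auto
    have "2 \<le> h a" if "a \<notin> {u, v}" using bij_betwE[OF h] that \<open>a < n\<close> by auto
    then show "f a < 2 \<longleftrightarrow> a \<in> {u, v}" by (auto simp: f_def)
  qed
  have "{a, b} \<in> E \<longleftrightarrow> {f a, f b} \<in> K2n n" if "a \<in> {0..<n}" "b \<in> {0..<n}" for a b
  proof -
    have "a < n" "b < n" using that by auto
    then show ?thesis
      unfolding E[OF \<open>a < n\<close> \<open>b < n\<close>] K2n_iff
      using hub[of a] hub[of b] by (metis not_le)
  qed
  then show ?thesis unfolding graph_iso_def using f by blast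
qed

section \<open>Comparison with the complete bipartite graph\<close>

theorem theorem3:
  fixes n :: nat and E :: "nat set set"
  assumes "real n \<ge> 2.16 * 10 ^ 17"
    and "simple_graph n E"
    and "planar n E"
    and "\<not> contains_C3C3 E"
  shows "graph_spectral_radius n E \<le> graph_spectral_radius n (K2n n) \<and>
         (graph_spectral_radius n E = graph_spectral_radius n (K2n n) \<longleftrightarrow> graph_iso n E (K2n n))"
proof -
  let ?r = "graph_spectral_radius n E" and ?k = "graph_spectral_radius n (K2n n)"
  have n: "n \<ge> 3" "n > 0" using assms(1) by auto
  obtain p \<gamma> where "plane_drawing n E p \<gamma>"
    using assms(2,3) by (rule planar_plane_drawing)
  then interpret plane_drawing n E p \<gamma> .
  \<comment> \<open>This case suffices: it forces an isomorphism, hence \<open>?r = ?k\<close>, so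
    \<open>?r\<close> can never exceed \<open>?k\<close>.\<close>
  have iso: "graph_iso n E (K2n n)" if "?k \<le> ?r"
  proof -
    obtain x u where u: "u < n" "x u = 1" and r: "0 \<le> ?r"
      and x: "\<forall>v<n. 0 \<le> x v \<and> x v \<le> 1 \<and> ?r * x v \<le> (\<Sum>w\<in>nbrs E {0..<n} v. x w)"
      by (rule spectral_radius_subinvariant[OF n(2), of E], rule that)
    have "sqrt (2 * (real n - 2)) \<le> ?r" using spectral_radius_K2n_ge[OF n(1)] that by linarith
    then have "2 * (real n - 2) \<le> ?r\<^sup>2" by (rule sqrt_le_D)
    then interpret large_subinvariant n E x ?r u
      using assms(1,4) u r x loop_free no_K33_subgraph degree_sum_bound by unfold_locales auto
    obtain v where "v < n" "u \<noteq> v"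
      "\<forall>a<n. \<forall>b<n. {a, b} \<in> E \<longleftrightarrow> (a \<in> {u, v}) \<noteq> (b \<in> {u, v})"
      using is_complete_bipartite by blast
    then show ?thesis using u(1) by (intro graph_iso_K2nI[of u n v]) blast+
  qed
  have eq: "?r = ?k" if "graph_iso n E (K2n n)"
    using graph_iso_spectral_radius_le[OF that n(2)]
      graph_iso_spectral_radius_le[OF graph_iso_sym[OF that] n(2)] by simp
  show ?thesis using iso eq by (cases "?k \<le> ?r") auto
qed

end
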